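(* Let $\mathcal K=\{k_1,\dots,k_N\}\subset\mathbb Z^3\setminus\{0\}$, $N\ge1$, satisfy $\mathcal K\cap(-\mathcal K)=\varnothing$, let $\varepsilon\in\{0,1\}$, and let the set of forcing profiles be $$\mathcal S_0=\{1:\varepsilon=1\}\cup\{\cos(k\cdot x),\sin(k\cdot x):k\in\mathcal K\}$$ (the first set being empty when $\varepsilon=0$). Set $$\mathcal A=\{\pm k:k\in\mathcal K\}\cup\{0:\varepsilon=1\},\qquad\Gamma_{\mathrm{pair}}=\operatorname{span}_{\mathbb Z}\{k+k':k,k'\in\mathcal A\}.$$ Then, for any $k^\circ\in\mathcal A$, $$\mathcal S_\infty^{\mathbb C}=\operatorname{span}_{\mathbb C}\{e^{i\ell\cdot x}:\ell\in k^\circ+\Gamma_{\mathrm{pair}}\}.$$ Consequently, the following are equivalent: (a) the forcing is cubically saturating; (b) $\Gamma_{\mathrm{pair}}=\mathbb Z^3$; (c) there are no nonzero $\theta\in\mathbb T^3$ and $c\in\{1,-1\}$ such that $e^{ik\cdot\theta}=c$ for every $k\in\mathcal K$, with $c=1$ when $\varepsilon=1$.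
   Context: $\mathbb T^3=(\mathbb R/2\pi\mathbb Z)^3$. Enumerate $\mathcal S_0=\{b_1,\dots,b_m\}$ and set $\mathcal S_{n+1}=\mathcal S_n\cup\{\phi b_jb_k:\phi\in\mathcal S_n,\ 1\le j,k\le m\}$, $\mathcal S_\infty=\operatorname{span}_{\mathbb R}\bigcup_{n\ge0}\mathcal S_n$; $\mathcal S_\infty^{\mathbb C}$ is the complexification (complex linear span) of $\mathcal S_\infty$. The forcing is cubically saturating if $\mathcal S_\infty$ is dense in the real Sobolev space $H^1(\mathbb T^3)$. *)

theory Defs
  imports "HOL-Analysis.Analysis" "HOL-Library.Function_Algebras"
begin

definition fscale :: "'a::comm_ring_1 \<Rightarrow> ('b \<Rightarrow> 'a) \<Rightarrow> 'b \<Rightarrow> 'a" where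
  "fscale c f = (\<lambda>x. c * f x)"

interpretation fun_module: module "fscale :: 'a::comm_ring_1 \<Rightarrow> ('b \<Rightarrow> 'a) \<Rightarrow> 'b \<Rightarrow> 'a"
  by standard (auto simp: fscale_def fun_eq_iff algebra_simps)

interpretation int_vec: module "(*s) :: int \<Rightarrow> int^'n \<Rightarrow> int^'n"
  by standard (auto simp: vec_eq_iff algebra_simps)

text \<open>Points of the torus \<open>(\<real>/2\<pi>\<int>)\<^sup>3\<close> are represented by points of \<open>\<real>\<^sup>3\<close>, with
  \<open>period_lattice\<close> the set of representatives of the zero element. Functions on the torus
  are represented by functions on \<open>\<real>\<^sup>3\<close> that are \<open>2\<pi>\<close>-periodic in every coordinate.\<close>

definition period_lattice :: "(real^3) set" where
  "period_lattice = {\<theta>. \<forall>j. \<exists>n::int. \<theta> $ j = 2 * pi * of_int n}"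

definition torus_periodic :: "(real^3 \<Rightarrow> 'a) \<Rightarrow> bool" where
  "torus_periodic f \<longleftrightarrow> (\<forall>x. \<forall>p\<in>period_lattice. f (x + p) = f x)"

definition fundamental_cube :: "(real^3) set" where
  "fundamental_cube = cbox 0 (\<chi> j. 2 * pi)"

definition freq_dot :: "int^3 \<Rightarrow> real^3 \<Rightarrow> real" where
  "freq_dot k x = (\<chi> j. real_of_int (k $ j)) \<bullet> x"

definition partial_deriv :: "3 \<Rightarrow> (real^3 \<Rightarrow> real) \<Rightarrow> real^3 \<Rightarrow> real" where
  "partial_deriv j f x = frechet_derivative f (at x) (axis j 1)"

text \<open>Differentiability of all iterated partial derivatives entails their continuity, so this
  is the class \<open>C\<^sup>\<infinity>\<close> of smooth functions on the torus.\<close>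

definition torus_smooth :: "(real^3 \<Rightarrow> real) \<Rightarrow> bool" where
  "torus_smooth f \<longleftrightarrow> torus_periodic f \<and> (\<forall>js. \<forall>x. foldr partial_deriv js f differentiable (at x))"

definition torus_L2 :: "(real^3 \<Rightarrow> real) set" where
  "torus_L2 = {f. torus_periodic f \<and> f \<in> borel_measurable borel \<and>
                  set_integrable lborel fundamental_cube (\<lambda>x. (f x)\<^sup>2)}"

definition is_weak_partial :: "3 \<Rightarrow> (real^3 \<Rightarrow> real) \<Rightarrow> (real^3 \<Rightarrow> real) \<Rightarrow> bool" where
  "is_weak_partial j f g \<longleftrightarrow> g \<in> torus_L2 \<and>
     (\<forall>\<phi>. torus_smooth \<phi> \<longrightarrow>
        (LINT x:fundamental_cube|lborel. f x * partial_deriv j \<phi> x) =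
        - (LINT x:fundamental_cube|lborel. g x * \<phi> x))"

text \<open>A weak partial derivative is unique up to null sets, so the seminorm below does not depend
  on the choice made here. Elements of the Sobolev space are represented by functions rather
  than by classes modulo null sets; density is not affected by this.\<close>

definition weak_partial :: "3 \<Rightarrow> (real^3 \<Rightarrow> real) \<Rightarrow> real^3 \<Rightarrow> real" where
  "weak_partial j f = (SOME g. is_weak_partial j f g)"

definition torus_H1 :: "(real^3 \<Rightarrow> real) set" where
  "torus_H1 = {f \<in> torus_L2. \<forall>j. \<exists>g. is_weak_partial j f g}"

definition H1_norm :: "(real^3 \<Rightarrow> real) \<Rightarrow> real" where
  "H1_norm f = sqrt ((LINT x:fundamental_cube|lborel. (f x)\<^sup>2) +
     (\<Sum>j\<in>UNIV. LINT x:fundamental_cube|lborel. (weak_partial j f x)\<^sup>2))"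

definition dense_in_H1 :: "(real^3 \<Rightarrow> real) set \<Rightarrow> bool" where
  "dense_in_H1 S \<longleftrightarrow> S \<subseteq> torus_H1 \<and>
     (\<forall>u\<in>torus_H1. \<forall>e>0. \<exists>f\<in>S. H1_norm (\<lambda>x. u x - f x) < e)"

primrec sat_level :: "(real^3 \<Rightarrow> real) set \<Rightarrow> nat \<Rightarrow> (real^3 \<Rightarrow> real) set" where
  "sat_level S0 0 = S0"
| "sat_level S0 (Suc n) = sat_level S0 n \<union>
     {(\<lambda>x. \<phi> x * b x * b' x) | \<phi> b b'. \<phi> \<in> sat_level S0 n \<and> b \<in> S0 \<and> b' \<in> S0}"

definition sat_space :: "(real^3 \<Rightarrow> real) set \<Rightarrow> (real^3 \<Rightarrow> real) set" where
  "sat_space S0 = fun_module.span (\<Union>n. sat_level S0 n)"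

definition sat_space_complex :: "(real^3 \<Rightarrow> real) set \<Rightarrow> (real^3 \<Rightarrow> complex) set" where
  "sat_space_complex S0 = fun_module.span ((\<lambda>f x. complex_of_real (f x)) ` sat_space S0)"

definition cubically_saturating :: "(real^3 \<Rightarrow> real) set \<Rightarrow> bool" where
  "cubically_saturating S0 \<longleftrightarrow> dense_in_H1 (sat_space S0)"

definition forcing_profiles :: "nat \<Rightarrow> (int^3) set \<Rightarrow> (real^3 \<Rightarrow> real) set" where
  "forcing_profiles \<epsilon> K = (if \<epsilon> = 1 then {\<lambda>x. 1} else {}) \<union>
     ((\<lambda>k x. cos (freq_dot k x)) ` K \<union> (\<lambda>k x. sin (freq_dot k x)) ` K)"

definition forcing_freqs :: "nat \<Rightarrow> (int^3) set \<Rightarrow> (int^3) set" where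
  "forcing_freqs \<epsilon> K = K \<union> uminus ` K \<union> (if \<epsilon> = 1 then {0} else {})"

definition pair_lattice :: "nat \<Rightarrow> (int^3) set \<Rightarrow> (int^3) set" where
  "pair_lattice \<epsilon> K = int_vec.span {k + k' | k k'. k \<in> forcing_freqs \<epsilon> K \<and> k' \<in> forcing_freqs \<epsilon> K}"

definition fourier_mode :: "int^3 \<Rightarrow> real^3 \<Rightarrow> complex" where
  "fourier_mode l x = exp (\<i> * complex_of_real (freq_dot l x))"

end

theory Submission
  imports Defs
begin

text \<open>
  Each profile is a combination of the modes \<open>exp (\<i> a \<cdot> x)\<close> with \<open>a\<close> in the symmetric set of
  forcing frequencies, and over \<open>\<complex>\<close> each such mode is a combination of profiles. Hence
  multiplying by two profiles moves a spectrum by sums \<open>a + a'\<close>, which generate the pair lattice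
  \<open>\<Gamma>\<close>: no spectrum leaves the coset \<open>k0 + \<Gamma>\<close>, and since \<open>-(a + a')\<close> is again such a sum, all of
  the coset is reached from the single mode \<open>k0\<close>. This is \<open>sat_space_complex_eq\<close>. Taking real and
  imaginary parts (\<open>Re_Im_span\<close>), the saturation space is the real span of the cosines and sines
  with frequency in the coset.

  If \<open>\<Gamma>\<close> is the whole lattice, the saturation space consists of all real trigonometric polynomials,
  and density in \<open>H\<^sup>1\<close> follows from density in \<open>L\<^sup>2\<close> (\<open>square_integrable_trig_approximable\<close>) by one
  observation. Let \<open>P\<close> be the \<open>L\<^sup>2\<close> projection of \<open>u\<close> onto the harmonics with frequency in a finite
  set \<open>F\<close>. That span is closed under differentiation, so by integration by parts the derivative of
  \<open>P\<close> is the projection of the weak derivative of \<open>u\<close> onto the same span. A set \<open>F\<close> that is large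
  enough to approximate \<open>u\<close> and its three weak derivatives separately therefore makes the single
  polynomial \<open>P\<close> approximate all four at once (\<open>harmonic_span_dense_H1\<close>). The density in \<open>L\<^sup>2\<close>
  is derived from the Stone-Weierstrass theorem on the image of the torus in \<open>\<complex>\<^sup>3\<close>, from where it
  passes to indicators of compact sets, of Borel sets, and to all square-integrable functions.

  If \<open>\<Gamma>\<close> is proper, so is its coset, and for \<open>l\<close> outside of the coset the function \<open>cos (l \<cdot> x)\<close> is
  orthogonal in \<open>L\<^sup>2\<close> to the saturation space; its distance to that space is its own norm.

  The last equivalence is duality for subgroups of \<open>\<int>\<^sup>3\<close>: a proper subgroup is annihilated by a
  nontrivial character (\<open>proper_subgroup_annihilator\<close>), and characters of \<open>\<int>\<^sup>3\<close> are the points \<open>\<theta>\<close> of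
  the torus. A character \<open>\<chi>\<close> is trivial on \<open>\<Gamma>\<close> exactly if \<open>\<chi> a * \<chi> a' = 1\<close> for all forcing
  frequencies; taking \<open>a = a'\<close> gives signs, and all the signs agree. If \<open>0\<close> is a forcing
  frequency, the common sign is \<open>1\<close>.
\<close>

section \<open>Integer subgroups, Fourier modes and harmonics\<close>

lemma int_subspaceI:
  fixes S :: "(int^'n) set"
  assumes "0 \<in> S" and add: "\<And>a b. a \<in> S \<Longrightarrow> b \<in> S \<Longrightarrow> a + b \<in> S"
    and neg: "\<And>a. a \<in> S \<Longrightarrow> - a \<in> S"
  shows "int_vec.subspace S"
proof (rule int_vec.subspaceI)
  fix c and a :: "int^'n" assume a: "a \<in> S"
  show "c *s a \<in> S"
  proof (induction c rule: int_induct[where k = 0])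
    case base
    then show ?case using assms(1) by simp
  next
    case (step1 i)
    then show ?case using add[OF step1(2) a] by (simp add: vector_sadd_rdistrib)
  next
    case (step2 i)
    then show ?case using add[OF step2(2) neg[OF a]] by (simp add: int_vec.scale_left_diff_distrib)
  qed
qed (use assms in auto)

lemma freq_dot_add [simp]: "freq_dot (k + l) x = freq_dot k x + freq_dot l x"
  by (simp add: freq_dot_def inner_vec_def algebra_simps sum.distrib)

lemma freq_dot_minus [simp]: "freq_dot (- k) x = - freq_dot k x"
  by (simp add: freq_dot_def inner_vec_def sum_negf)

lemma freq_dot_diff [simp]: "freq_dot (k - l) x = freq_dot k x - freq_dot l x"
  by (simp add: freq_dot_def inner_vec_def algebra_simps sum_subtractf)

lemma freq_dot_0 [simp]: "freq_dot 0 x = 0"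
  by (simp add: freq_dot_def inner_vec_def)

lemma freq_dot_add_right [simp]: "freq_dot k (x + y) = freq_dot k x + freq_dot k y"
  by (simp add: freq_dot_def inner_add_right)

lemma freq_dot_axis [simp]: "freq_dot (axis j n) x = of_int n * x $ j"
proof -
  have "(\<chi> i. real_of_int (axis j n $ i)) = axis j (real_of_int n)"
    by (simp add: vec_eq_iff axis_def)
  then show ?thesis by (simp add: freq_dot_def inner_axis' )
qed

lemma freq_dot_axis_right [simp]: "freq_dot k (axis j t) = of_int (k $ j) * t"
  by (simp add: freq_dot_def inner_axis)

lemma fourier_mode_eq: "fourier_mode k x = complex_of_real (cos (freq_dot k x)) + \<i> * complex_of_real (sin (freq_dot k x))"
  by (simp add: fourier_mode_def exp_Euler cos_of_real sin_of_real)

lemma fourier_mode_add: "fourier_mode (k + l) x = fourier_mode k x * fourier_mode l x"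
  by (simp add: fourier_mode_def algebra_simps exp_add)

text \<open>Real and imaginary parts of a complex combination are real combinations of the real and imaginary
  parts of its terms. This is how statements on the complexification return to the real space.\<close>

lemma Re_Im_span:
  fixes V :: "('b \<Rightarrow> real) set"
  assumes V: "fun_module.subspace V"
    and H: "\<And>h. h \<in> H \<Longrightarrow> (\<lambda>x. Re (h x)) \<in> V \<and> (\<lambda>x. Im (h x)) \<in> V"
    and h: "h \<in> fun_module.span H"
  shows "(\<lambda>x. Re (h x)) \<in> V \<and> (\<lambda>x. Im (h x)) \<in> V"
  using h
proof (induction rule: fun_module.span_induct_alt)
  case base
  then show ?case using fun_module.subspace_0[OF V] by (simp add: zero_fun_def)
next
  case (step c x y)
  note X = H[OF step(1)]
  have "(\<lambda>t. Re ((fscale c x + y) t)) =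
     fscale (Re c) (\<lambda>t. Re (x t)) + (fscale (- Im c) (\<lambda>t. Im (x t)) + (\<lambda>t. Re (y t)))"
    "(\<lambda>t. Im ((fscale c x + y) t)) =
     fscale (Re c) (\<lambda>t. Im (x t)) + (fscale (Im c) (\<lambda>t. Re (x t)) + (\<lambda>t. Im (y t)))"
    by (auto simp: fscale_def)
  then show ?case using X step(2) V
    by (simp only: fun_module.subspace_add fun_module.subspace_scale)
qed

definition harmonics :: "(int^3) set \<Rightarrow> (real^3 \<Rightarrow> real) set" where
  "harmonics F = (\<lambda>k x. cos (freq_dot k x)) ` F \<union> (\<lambda>k x. sin (freq_dot k x)) ` F"

lemma in_harmonics:
  assumes "k \<in> F"
  shows "(\<lambda>x. cos (freq_dot k x)) \<in> harmonics F" "(\<lambda>x. sin (freq_dot k x)) \<in> harmonics F"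
  using assms by (auto simp: harmonics_def)

lemma harmonics_mono: "A \<subseteq> B \<Longrightarrow> harmonics A \<subseteq> harmonics B"
  by (auto simp: harmonics_def)

lemma Re_span_fourier_modes:
  assumes "(\<lambda>x. complex_of_real (f x)) \<in> fun_module.span (fourier_mode ` B)"
  shows "f \<in> fun_module.span (harmonics B)"
proof -
  have "(\<lambda>x. Re (complex_of_real (f x))) \<in> fun_module.span (harmonics B) \<and>
      (\<lambda>x. Im (complex_of_real (f x))) \<in> fun_module.span (harmonics B)"
  proof (rule Re_Im_span[OF _ _ assms])
    fix h assume "h \<in> fourier_mode ` B"
    then obtain k where k: "k \<in> B" "h = fourier_mode k" by auto
    then show "(\<lambda>x. Re (h x)) \<in> fun_module.span (harmonics B) \<and> (\<lambda>x. Im (h x)) \<in> fun_module.span (harmonics B)"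
      by (auto simp: fourier_mode_eq harmonics_def intro!: fun_module.span_base)
  qed auto
  then show ?thesis by simp
qed

text \<open>By bilinearity, products of two spans are controlled by products of the generators. Inclusions
  between products of function spaces below reduce to a computation with single modes.\<close>

lemma span_mult_image:
  assumes f: "f \<in> fun_module.span A" and g: "g \<in> fun_module.span B"
    and AB: "\<And>a b. a \<in> A \<Longrightarrow> b \<in> B \<Longrightarrow> (\<lambda>x. a x * b x) \<in> fun_module.span C"
  shows "(\<lambda>x. f x * g x) \<in> fun_module.span C"
proof -
  have *: "(\<lambda>x. a x * g x) \<in> fun_module.span C" if a: "a \<in> A" for a
    using g
  proof (induction rule: fun_module.span_induct_alt)
    case base
    then show ?case using fun_module.span_zero by (simp add: zero_fun_def)
  next
    case (step c x y)
    have "(\<lambda>t. a t * (fscale c x + y) t) = fscale c (\<lambda>t. a t * x t) + (\<lambda>t. a t * y t)"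
      by (auto simp: fscale_def algebra_simps)
    then show ?case using AB[OF a step(1)] step(2)
      by (auto intro!: fun_module.span_add fun_module.span_scale)
  qed
  show ?thesis using f
  proof (induction rule: fun_module.span_induct_alt)
    case base
    then show ?case using fun_module.span_zero by (simp add: zero_fun_def)
  next
    case (step c x y)
    have "(\<lambda>t. (fscale c x + y) t * g t) = fscale c (\<lambda>t. x t * g t) + (\<lambda>t. y t * g t)"
      by (auto simp: fscale_def algebra_simps)
    then show ?case using *[OF step(1)] step(2)
      by (auto intro!: fun_module.span_add fun_module.span_scale)
  qed
qed

section \<open>The Fourier modes of the saturation space\<close>

context
  fixes K :: "(int^3) set" and \<epsilon> :: nat
begin

private abbreviation (input) "A \<equiv> forcing_freqs \<epsilon> K"
private abbreviation (input) "\<Gamma> \<equiv> pair_lattice \<epsilon> K"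
private abbreviation (input) "S0 \<equiv> forcing_profiles \<epsilon> K"

lemma forcing_freqs_uminus: "a \<in> A \<Longrightarrow> - a \<in> A"
  by (auto simp: forcing_freqs_def image_iff split: if_splits)

lemma pair_lattice_subspace: "int_vec.subspace \<Gamma>"
  by (simp add: pair_lattice_def)

lemma pair_latticeI: "a \<in> A \<Longrightarrow> b \<in> A \<Longrightarrow> a + b \<in> \<Gamma>"
  by (auto simp: pair_lattice_def intro!: int_vec.span_base)

text \<open>The difference of two forcing frequencies lies in the pair lattice, because the set of forcing
  frequencies is symmetric. Hence the coset does not depend on its representative.\<close>

lemma pair_lattice_coset_eq:
  assumes "a \<in> A" "b \<in> A"
  shows "{a + g | g. g \<in> \<Gamma>} \<subseteq> {b + g | g. g \<in> \<Gamma>}"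
proof safe
  fix g assume g: "g \<in> \<Gamma>"
  have "a + (- b) + g \<in> \<Gamma>"
    by (intro int_vec.subspace_add[OF pair_lattice_subspace] pair_latticeI g assms forcing_freqs_uminus)
  then show "\<exists>g'. a + g = b + g' \<and> g' \<in> \<Gamma>" by (intro exI[of _ "a + (-b) + g"]) auto
qed

lemma profile_in_mode_span:
  assumes "b \<in> S0"
  shows "(\<lambda>x. complex_of_real (b x)) \<in> fun_module.span (fourier_mode ` A)"
proof -
  have c: "(\<lambda>x. complex_of_real (cos (freq_dot k x))) =
     fscale (1/2) (fourier_mode k) + fscale (1/2) (fourier_mode (- k))" for k
    by (auto simp: fscale_def fourier_mode_eq field_simps)
  have s: "(\<lambda>x. complex_of_real (sin (freq_dot k x))) =
     fscale (-\<i>/2) (fourier_mode k) + fscale (\<i>/2) (fourier_mode (- k))" for k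
    by (auto simp: fscale_def fourier_mode_eq field_simps)
  have o: "(\<lambda>x. 1) = fourier_mode 0" by (auto simp: fourier_mode_def)
  from assms consider "\<epsilon> = 1" "b = (\<lambda>x. 1)" | k where "k \<in> K" "b = (\<lambda>x. cos (freq_dot k x))"
    | k where "k \<in> K" "b = (\<lambda>x. sin (freq_dot k x))"
    by (auto simp: forcing_profiles_def split: if_splits)
  then show ?thesis
  proof cases
    case 1
    then show ?thesis
      by (auto simp: o forcing_freqs_def intro!: fun_module.span_base)
  next
    case (2 k)
    then have "k \<in> A" "- k \<in> A" by (auto simp: forcing_freqs_def)
    then show ?thesis unfolding 2 c
      by (intro fun_module.span_add fun_module.span_scale fun_module.span_base) auto
  next
    case (3 k)
    then have "k \<in> A" "- k \<in> A" by (auto simp: forcing_freqs_def)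
    then show ?thesis unfolding 3 s
      by (intro fun_module.span_add fun_module.span_scale fun_module.span_base) auto
  qed
qed

lemma mode_in_profile_span:
  assumes "a \<in> A"
  shows "fourier_mode a \<in> fun_module.span ((\<lambda>f x. complex_of_real (f x)) ` S0)"
proof -
  let ?R = "fun_module.span ((\<lambda>f x. complex_of_real (f x)) ` S0)"
  have o: "(\<lambda>x. complex_of_real 1) = fourier_mode 0" by (auto simp: fourier_mode_def)
  have m: "fourier_mode k = (\<lambda>x. complex_of_real (cos (freq_dot k x))) +
      fscale \<i> (\<lambda>x. complex_of_real (sin (freq_dot k x)))" for k
    by (auto simp: fscale_def fourier_mode_eq)
  have m': "fourier_mode (- k) = (\<lambda>x. complex_of_real (cos (freq_dot k x))) +
      fscale (- \<i>) (\<lambda>x. complex_of_real (sin (freq_dot k x)))" for k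
    by (auto simp: fscale_def fourier_mode_eq)
  have cs: "(\<lambda>x. complex_of_real (cos (freq_dot k x))) \<in> ?R"
      "(\<lambda>x. complex_of_real (sin (freq_dot k x))) \<in> ?R" if "k \<in> K" for k
    using that by (auto simp: forcing_profiles_def intro!: fun_module.span_base image_eqI[OF refl])
  from assms consider "\<epsilon> = 1" "a = 0" | "a \<in> K" | k where "k \<in> K" "a = - k"
    by (auto simp: forcing_freqs_def split: if_splits)
  then show ?thesis
  proof cases
    case 1
    then show ?thesis
      by (auto simp: o[symmetric] forcing_profiles_def intro!: fun_module.span_base image_eqI[OF refl])
  next
    case 2
    then show ?thesis unfolding m
      by (intro fun_module.span_add fun_module.span_scale cs)
  next
    case (3 k)
    then show ?thesis unfolding 3 m'
      by (intro fun_module.span_add fun_module.span_scale cs)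
  qed
qed

lemma sat_level_in_mode_span:
  assumes "k0 \<in> A" "f \<in> sat_level S0 n"
  shows "(\<lambda>x. complex_of_real (f x)) \<in> fun_module.span (fourier_mode ` {k0 + g | g. g \<in> \<Gamma>})"
  using assms(2)
proof (induction n arbitrary: f)
  case 0
  have "A \<subseteq> {k0 + g | g. g \<in> \<Gamma>}"
  proof
    fix a assume "a \<in> A"
    from pair_lattice_coset_eq[OF this assms(1)] have "a + 0 \<in> {k0 + g | g. g \<in> \<Gamma>}"
      using int_vec.subspace_0[OF pair_lattice_subspace] by blast
    then show "a \<in> {k0 + g | g. g \<in> \<Gamma>}" by simp
  qed
  from fun_module.span_mono[OF image_mono[OF this]] profile_in_mode_span[of f] 0
  show ?case by auto
next
  case (Suc n)
  let ?C = "fun_module.span (fourier_mode ` {k0 + g | g. g \<in> \<Gamma>})"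
  have step: "(\<lambda>x. h x * complex_of_real (b x) * complex_of_real (b' x)) \<in> ?C"
    if h: "h \<in> ?C" and b: "b \<in> S0" "b' \<in> S0" for h b b'
  proof -
    have bb: "(\<lambda>x. complex_of_real (b x) * complex_of_real (b' x)) \<in> fun_module.span (fourier_mode ` \<Gamma>)"
    proof (rule span_mult_image[OF profile_in_mode_span[OF b(1)] profile_in_mode_span[OF b(2)]])
      fix p q assume "p \<in> fourier_mode ` A" "q \<in> fourier_mode ` A"
      then obtain k l where kl: "k \<in> A" "l \<in> A" "p = fourier_mode k" "q = fourier_mode l" by auto
      have "(\<lambda>x. p x * q x) = fourier_mode (k + l)" by (auto simp: kl fourier_mode_add)
      then show "(\<lambda>x. p x * q x) \<in> fun_module.span (fourier_mode ` \<Gamma>)"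
        using pair_latticeI[OF kl(1,2)] by (auto intro: fun_module.span_base)
    qed
    have "(\<lambda>x. h x * (complex_of_real (b x) * complex_of_real (b' x))) \<in> ?C"
    proof (rule span_mult_image[OF h bb])
      fix p q assume "p \<in> fourier_mode ` {k0 + g | g. g \<in> \<Gamma>}" "q \<in> fourier_mode ` \<Gamma>"
      then obtain k l where kl: "k \<in> \<Gamma>" "l \<in> \<Gamma>" "p = fourier_mode (k0 + k)" "q = fourier_mode l" by auto
      have "(\<lambda>x. p x * q x) = fourier_mode (k0 + (k + l))" by (auto simp: kl fourier_mode_add)
      then show "(\<lambda>x. p x * q x) \<in> ?C"
        using int_vec.subspace_add[OF pair_lattice_subspace kl(1,2)] by (auto intro: fun_module.span_base)
    qed
    then show ?thesis by (simp add: mult.assoc)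
  qed
  from Suc.prems show ?case using Suc.IH step by auto
qed

lemma sat_space_mult:
  assumes f: "f \<in> sat_space S0" and b: "b \<in> S0" "b' \<in> S0"
  shows "(\<lambda>x. f x * b x * b' x) \<in> sat_space S0"
  using f unfolding sat_space_def
proof (induction rule: fun_module.span_induct_alt)
  case base
  then show ?case using fun_module.span_zero by (simp add: zero_fun_def)
next
  case (step c x y)
  from step(1) obtain n where "x \<in> sat_level S0 n" by auto
  then have "(\<lambda>t. x t * b t * b' t) \<in> sat_level S0 (Suc n)" using b unfolding sat_level.simps by blast
  then have "(\<lambda>t. x t * b t * b' t) \<in> fun_module.span (\<Union>n. sat_level S0 n)"
    by (rule fun_module.span_base[OF UN_I[OF UNIV_I]])
  moreover have "(\<lambda>t. (fscale c x + y) t * b t * b' t) =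
     fscale c (\<lambda>t. x t * b t * b' t) + (\<lambda>t. y t * b t * b' t)"
    by (auto simp: fscale_def algebra_simps)
  ultimately show ?case using step(2)
    by (auto intro!: fun_module.span_add fun_module.span_scale)
qed

text \<open>A product of two modes is a combination of products of two profiles, so it acts on the
  complexified space although the single modes need not.\<close>

lemma sat_space_complex_mult_mode:
  assumes h: "h \<in> sat_space_complex S0" and a: "a \<in> A" "a' \<in> A"
  shows "(\<lambda>x. h x * fourier_mode (a + a') x) \<in> sat_space_complex S0"
proof -
  let ?c = "\<lambda>f x. complex_of_real (f x)"
  have "(\<lambda>x. h x * (fourier_mode a x * fourier_mode a' x)) \<in> sat_space_complex S0"
    unfolding sat_space_complex_def
  proof (rule span_mult_image[OF h[unfolded sat_space_complex_def]])
    show "(\<lambda>x. fourier_mode a x * fourier_mode a' x) \<in>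
       fun_module.span ((\<lambda>(b, b') x. ?c b x * ?c b' x) ` (S0 \<times> S0))"
      by (rule span_mult_image[OF mode_in_profile_span[OF a(1)] mode_in_profile_span[OF a(2)]])
        (auto intro!: fun_module.span_base)
  next
    fix f p assume "f \<in> ?c ` sat_space S0" "p \<in> (\<lambda>(b, b') x. ?c b x * ?c b' x) ` (S0 \<times> S0)"
    then obtain g b b' where *: "g \<in> sat_space S0" "b \<in> S0" "b' \<in> S0" "f = ?c g" "p = (\<lambda>x. ?c b x * ?c b' x)"
      by auto
    have "(\<lambda>x. f x * p x) = ?c (\<lambda>x. g x * b x * b' x)" by (auto simp: *)
    then show "(\<lambda>x. f x * p x) \<in> fun_module.span (?c ` sat_space S0)"
      using fun_module.span_base[OF imageI[OF sat_space_mult[OF *(1-3)], of ?c]] by (simp only:)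
  qed
  then show ?thesis by (simp add: fourier_mode_add)
qed

text \<open>One inclusion follows the spectrum through the levels. For the other, the translations that preserve
  the set of frequencies present form a subgroup containing the generators of the pair lattice, and
  \<open>k0\<close> is present.\<close>

lemma sat_space_complex_eq:
  assumes k0: "k0 \<in> A"
  shows "sat_space_complex S0 = fun_module.span (fourier_mode ` {k0 + g | g. g \<in> \<Gamma>})"
proof
  let ?c = "\<lambda>f x. complex_of_real (f x)"
  let ?C = "fun_module.span (fourier_mode ` {k0 + g | g. g \<in> \<Gamma>})"
  have "?c f \<in> ?C" if "f \<in> sat_space S0" for f
    using that unfolding sat_space_def
  proof (induction rule: fun_module.span_induct_alt)
    case base
    then show ?case using fun_module.span_zero by (simp add: zero_fun_def)
  next
    case (step r x y)
    have "?c (fscale r x + y) = fscale (of_real r) (?c x) + ?c y"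
      by (auto simp: fscale_def)
    moreover have "?c x \<in> ?C" using step(1) sat_level_in_mode_span[OF k0] by auto
    ultimately show ?case using step(2)
      by (auto intro!: fun_module.span_add fun_module.span_scale)
  qed
  then show "sat_space_complex S0 \<subseteq> ?C"
    unfolding sat_space_complex_def by (intro fun_module.span_minimal) auto
next
  let ?M = "sat_space_complex S0"
  have M: "fun_module.subspace ?M" by (simp add: sat_space_complex_def)
  have 0: "fourier_mode k0 \<in> ?M"
  proof -
    have "S0 \<subseteq> sat_space S0"
      unfolding sat_space_def using fun_module.span_superset by (fastforce intro: UN_I[of 0])
    then show ?thesis unfolding sat_space_complex_def
      using mode_in_profile_span[OF k0] fun_module.span_mono[OF image_mono] by blast
  qed
  \<comment> \<open>Only translations by generators are known to preserve the space. Requiring both directions makes the set of admissible translations a subgroup.\<close>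
  define G where "G = {g. \<forall>l. (fourier_mode l \<in> ?M \<longrightarrow> fourier_mode (l + g) \<in> ?M) \<and>
      (fourier_mode l \<in> ?M \<longrightarrow> fourier_mode (l - g) \<in> ?M)}"
  have G: "int_vec.subspace G"
  proof (rule int_subspaceI)
    fix a b assume ab: "a \<in> G" "b \<in> G"
    have "fourier_mode (l + (a + b)) \<in> ?M" "fourier_mode (l - (a + b)) \<in> ?M"
      if l: "fourier_mode l \<in> ?M" for l
    proof -
      have "fourier_mode (l + a + b) \<in> ?M" "fourier_mode (l - a - b) \<in> ?M"
        using ab l unfolding G_def by blast+
      then show "fourier_mode (l + (a + b)) \<in> ?M" "fourier_mode (l - (a + b)) \<in> ?M"
        by (simp_all add: algebra_simps)
    qed
    then show "a + b \<in> G" by (auto simp: G_def)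
  qed (auto simp: G_def)
  have pair: "fourier_mode (l + (a + a')) \<in> ?M" if "fourier_mode l \<in> ?M" "a \<in> A" "a' \<in> A" for l a a'
  proof -
    have "fourier_mode (l + (a + a')) = (\<lambda>x. fourier_mode l x * fourier_mode (a + a') x)"
      by (rule ext) (rule fourier_mode_add)
    then show ?thesis using sat_space_complex_mult_mode[OF that] by simp
  qed
  have "\<Gamma> \<subseteq> G" unfolding pair_lattice_def
  proof (rule int_vec.span_minimal[OF _ G], safe)
    fix a a' assume a: "a \<in> A" "a' \<in> A"
    have "fourier_mode (l - (a + a')) \<in> ?M" if "fourier_mode l \<in> ?M" for l
      using pair[OF that forcing_freqs_uminus forcing_freqs_uminus, OF a] by (simp add: algebra_simps)
    then show "a + a' \<in> G" unfolding G_def using pair a by blast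
  qed
  then have "fourier_mode (k0 + g) \<in> ?M" if "g \<in> \<Gamma>" for g
    using 0 that unfolding G_def by blast
  then show "fun_module.span (fourier_mode ` {k0 + g | g. g \<in> \<Gamma>}) \<subseteq> ?M"
    by (intro fun_module.span_minimal[OF _ M]) auto
qed

end

section \<open>Characters of subgroups of the integer lattice\<close>

text \<open>The absolute value is prescribed because the values on the unit vectors become the exponentials
  of a point of the torus.\<close>

definition character_on :: "(int^'n) set \<Rightarrow> (int^'n \<Rightarrow> complex) \<Rightarrow> bool" where
  "character_on H \<xi> \<longleftrightarrow> (\<forall>a\<in>H. \<forall>b\<in>H. \<xi> (a + b) = \<xi> a * \<xi> b) \<and> (\<forall>a\<in>H. cmod (\<xi> a) = 1)"

lemma character_on_0: "character_on H \<xi> \<Longrightarrow> 0 \<in> H \<Longrightarrow> \<xi> 0 = 1"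
proof -
  assume a: "character_on H \<xi>" "0 \<in> H"
  then have "\<xi> (0 + 0) = \<xi> 0 * \<xi> 0" "cmod (\<xi> 0) = 1" unfolding character_on_def by blast+
  then show ?thesis by auto
qed

lemma character_on_uminus:
  assumes "character_on H \<xi>" "int_vec.subspace H" "a \<in> H"
  shows "\<xi> (- a) = inverse (\<xi> a)"
proof -
  have "- a \<in> H" "0 \<in> H" using assms int_vec.subspace_neg int_vec.subspace_0 by auto
  then have "\<xi> (a + - a) = \<xi> a * \<xi> (- a)" "\<xi> 0 = 1"
    using assms character_on_0 unfolding character_on_def by blast+
  then show ?thesis by (simp add: inverse_unique)
qed

lemma character_on_scale:
  assumes H: "character_on H \<xi>" "int_vec.subspace H" "a \<in> H"
  shows "\<xi> (n *s a) = \<xi> a powi n"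
proof -
  have nz: "\<xi> a \<noteq> 0" using H unfolding character_on_def by force
  have m: "i *s a \<in> H" for i using H int_vec.subspace_scale by auto
  show ?thesis
  proof (induction n rule: int_induct[where k = 0])
    case base
    then show ?case using character_on_0[OF H(1) int_vec.subspace_0[OF H(2)]] by simp
  next
    case (step1 i)
    have "\<xi> (i *s a + a) = \<xi> (i *s a) * \<xi> a" using H m unfolding character_on_def by blast
    then show ?case using step1 nz by (simp add: vector_sadd_rdistrib power_int_add)
  next
    case (step2 i)
    have "\<xi> (i *s a + - a) = \<xi> (i *s a) * \<xi> (- a)"
      using H m int_vec.subspace_neg[OF H(2,3)] unfolding character_on_def by blast
    then show ?case using step2 nz character_on_uminus[OF H]
      by (simp add: int_vec.scale_left_diff_distrib power_int_diff field_simps)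
  qed
qed

text \<open>For \<open>w = 1\<close> a primitive \<open>m\<close>-th root of unity avoids \<open>1\<close>; for \<open>w \<noteq> 1\<close> every root does.\<close>

lemma unit_root_avoiding_1:
  assumes "cmod w = 1" "m > 0"
  obtains z where "z ^ m = w" "cmod z = 1" "m \<noteq> 1 \<Longrightarrow> z \<noteq> 1"
proof (cases "w = 1 \<and> m \<noteq> 1")
  case True
  let ?z = "exp (2 * of_real pi * \<i> * of_nat 1 / of_nat m)"
  have "?z ^ m = 1" using assms(2) by (intro complex_root_unity) auto
  moreover have "?z \<noteq> 1" using True assms(2) complex_root_unity_eq_1[of m 1] by simp
  moreover have "cmod ?z = 1" by (simp add: norm_exp_eq_Re)
  ultimately show ?thesis using that[of ?z] True by simp
next
  case False
  have "w \<noteq> 0" using assms(1) by auto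
  let ?z = "exp (Ln w / of_nat m)"
  have z: "?z ^ m = w" using assms \<open>w \<noteq> 0\<close> by (simp add: exp_of_nat_mult[symmetric])
  moreover have "cmod ?z = 1" using \<open>w \<noteq> 0\<close> assms by (simp add: norm_exp_eq_Re)
  moreover have "?z \<noteq> 1" if "m \<noteq> 1"
  proof
    assume "?z = 1"
    then have "w = 1" using z by simp
    then show False using False that by simp
  qed
  ultimately show ?thesis using that by blast
qed

text \<open>The extension is determined by its value \<open>z\<close> at \<open>e\<close>. The only constraint on \<open>z\<close> comes from the
  multiples of \<open>e\<close> in \<open>H\<close>. If \<open>m\<close> is the least positive integer with \<open>m e \<in> H\<close>, it says that \<open>z\<close> is
  an \<open>m\<close>-th root of the given value at \<open>m e\<close>; if there is none, \<open>z\<close> is arbitrary. For \<open>e \<notin> H\<close> there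
  is room to choose \<open>z \<noteq> 1\<close>, which makes the character nontrivial.\<close>

lemma character_extend_one:
  fixes H :: "(int^'n) set"
  assumes sub: "int_vec.subspace H" and chr: "character_on H \<xi>"
  obtains \<xi>' where "\<And>a. a \<in> H \<Longrightarrow> \<xi>' a = \<xi> a" "character_on (int_vec.span (insert e H)) \<xi>'"
    "e \<notin> H \<Longrightarrow> \<xi>' e \<noteq> 1"
proof -
  obtain z where z: "cmod z = 1" "\<And>n. n *s e \<in> H \<Longrightarrow> \<xi> (n *s e) = z powi n" "e \<notin> H \<Longrightarrow> z \<noteq> 1"
  proof (cases "\<exists>m::nat. m > 0 \<and> int m *s e \<in> H")
    case True
    define m where "m = (LEAST m::nat. m > 0 \<and> int m *s e \<in> H)"
    have m: "m > 0" "int m *s e \<in> H" using LeastI_ex[OF True] unfolding m_def by auto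
    have least: "m \<le> k" if "k > 0" "int k *s e \<in> H" for k
      unfolding m_def using that by (auto intro: Least_le)
    have "cmod (\<xi> (int m *s e)) = 1" using m chr by (auto simp: character_on_def)
    from unit_root_avoiding_1[OF this m(1)] obtain z where
      z: "z ^ m = \<xi> (int m *s e)" "cmod z = 1" "m \<noteq> 1 \<Longrightarrow> z \<noteq> 1" by metis
    show ?thesis
    proof (rule that[of z])
      show "e \<notin> H \<Longrightarrow> z \<noteq> 1" using z(3) m(2) by fastforce
      fix n assume n: "n *s e \<in> H"
      \<comment> \<open>Division with remainder and minimality of \<open>m\<close> show that \<open>m\<close> divides \<open>n\<close>.\<close>
      have "n *s e - (n div int m) *s (int m *s e) \<in> H"
        using n m sub int_vec.subspace_diff int_vec.subspace_scale by blast
      also have "n *s e - (n div int m) *s (int m *s e) = (n mod int m) *s e"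
        by (simp add: vec_eq_iff minus_div_mult_eq_mod[symmetric] algebra_simps)
      finally have r: "int (nat (n mod int m)) *s e \<in> H" using m by simp
      have "n mod int m = 0"
      proof (rule ccontr)
        assume "n mod int m \<noteq> 0"
        moreover have "n mod int m \<ge> 0" "n mod int m < int m" using m by auto
        ultimately show False using least[OF _ r] by auto
      qed
      then obtain q where q: "n = int m * q" by (auto elim: dvdE)
      have "\<xi> (n *s e) = \<xi> (q *s (int m *s e))" by (simp add: q mult.commute)
      also have "\<dots> = (z ^ m) powi q" using character_on_scale[OF chr sub m(2)] z by simp
      also have "\<dots> = z powi n" by (simp add: q power_int_mult)
      finally show "\<xi> (n *s e) = z powi n" .
    qed (use z in auto)
  next
    case False
    show ?thesis
    proof (rule that[of "-1"])
      fix n assume n: "n *s e \<in> H"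
      have "n = 0"
      proof (rule ccontr)
        assume "n \<noteq> 0"
        have "(- n) *s e \<in> H" using int_vec.subspace_neg[OF sub n] by simp
        then have "int (nat \<bar>n\<bar>) *s e \<in> H" using n by (cases "n \<ge> 0") auto
        then show False using False \<open>n \<noteq> 0\<close> by (metis zero_less_abs_iff zero_less_nat_eq)
      qed
      then show "\<xi> (n *s e) = (-1) powi n"
        using character_on_0[OF chr int_vec.subspace_0[OF sub]] by simp
    qed auto
  qed
  have znz: "z \<noteq> 0" using z(1) by auto
  \<comment> \<open>A representation \<open>x = h + n e\<close> is chosen arbitrarily; the constraint on \<open>z\<close> makes the value independent of it.\<close>
  define \<xi>' where "\<xi>' x = (let p = (SOME p. fst p \<in> H \<and> x = fst p + snd p *s e) in
      \<xi> (fst p) * z powi (snd p))" for x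
  have val: "\<xi>' (h + n *s e) = \<xi> h * z powi n" if h: "h \<in> H" for h n
  proof -
    define p where "p = (SOME p. fst p \<in> H \<and> h + n *s e = fst p + snd p *s e)"
    have p: "fst p \<in> H \<and> h + n *s e = fst p + snd p *s e"
      unfolding p_def by (rule someI[of _ "(h, n)"]) (use h in auto)
    have eq: "(n - snd p) *s e = fst p + - h"
    proof -
      have "(n - snd p) *s e = n *s e - snd p *s e" by (rule int_vec.scale_left_diff_distrib)
      also have "\<dots> = fst p - h" using p by (metis add_diff_cancel_left' add_diff_eq diff_diff_eq2 diff_add_eq)
      finally show ?thesis by simp
    qed
    have mh: "- h \<in> H" using h sub int_vec.subspace_neg by blast
    have "(n - snd p) *s e \<in> H" unfolding eq using p mh sub int_vec.subspace_add by blast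
    then have "z powi (n - snd p) = \<xi> (fst p + - h)" using z(2) eq by metis
    also have "\<dots> = \<xi> (fst p) * \<xi> (- h)" using chr p mh unfolding character_on_def by blast
    also have "\<dots> = \<xi> (fst p) / \<xi> h" using character_on_uminus[OF chr sub h] by (simp add: divide_inverse)
    finally have "z powi n / z powi (snd p) = \<xi> (fst p) / \<xi> h" using znz by (simp add: power_int_diff)
    moreover have "\<xi> h \<noteq> 0" using chr h unfolding character_on_def by force
    ultimately have "\<xi> (fst p) * z powi (snd p) = \<xi> h * z powi n" using znz by (simp add: field_simps)
    then show ?thesis unfolding \<xi>'_def p_def by (simp add: Let_def)
  qed
  show ?thesis
  proof (rule that)
    show "\<xi>' a = \<xi> a" if "a \<in> H" for a using val[OF that, of 0] by simp
    show "\<xi>' e \<noteq> 1" if "e \<notin> H"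
      using val[OF int_vec.subspace_0[OF sub], of 1] z(3)[OF that]
        character_on_0[OF chr int_vec.subspace_0[OF sub]] by simp
    have dec: "\<exists>h n. h \<in> H \<and> x = h + n *s e" if "x \<in> int_vec.span (insert e H)" for x
    proof -
      from that obtain n where "x - n *s e \<in> int_vec.span H"
        by (auto simp: int_vec.span_breakdown_eq)
      then have "x - n *s e \<in> H" using sub int_vec.span_eq_iff by blast
      then show ?thesis by (intro exI[of _ "x - n *s e"] exI[of _ n]) auto
    qed
    show "character_on (int_vec.span (insert e H)) \<xi>'"
      unfolding character_on_def
    proof (intro conjI ballI)
      fix x y assume "x \<in> int_vec.span (insert e H)" "y \<in> int_vec.span (insert e H)"
      then obtain h n h' n' where *: "h \<in> H" "x = h + n *s e" "h' \<in> H" "y = h' + n' *s e"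
        using dec by meson
      have "x + y = (h + h') + (n + n') *s e" by (simp add: * vec_eq_iff algebra_simps)
      then have "\<xi>' (x + y) = \<xi> (h + h') * z powi (n + n')"
        using val int_vec.subspace_add[OF sub *(1,3)] by metis
      also have "\<xi> (h + h') = \<xi> h * \<xi> h'" using * chr unfolding character_on_def by blast
      finally show "\<xi>' (x + y) = \<xi>' x * \<xi>' y" using val * znz by (simp add: power_int_add)
    next
      fix x assume "x \<in> int_vec.span (insert e H)"
      then obtain h n where *: "h \<in> H" "x = h + n *s e" using dec by meson
      then show "cmod (\<xi>' x) = 1" using val z(1) chr by (simp add: norm_mult norm_power_int character_on_def)
    qed
  qed
qed

lemma character_extend_finite:
  fixes H :: "(int^'n) set"
  assumes "finite B" "int_vec.subspace H" "character_on H \<xi>"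
  obtains \<xi>' where "\<And>a. a \<in> H \<Longrightarrow> \<xi>' a = \<xi> a" "character_on (int_vec.span (B \<union> H)) \<xi>'"
  using assms(1)
proof (induction B arbitrary: thesis rule: finite_induct)
  case empty
  have "int_vec.span H = H" using assms(2) int_vec.span_eq_iff by blast
  then have "character_on (int_vec.span ({} \<union> H)) \<xi>" using assms(3) by (simp only: Un_empty_left)
  then show ?case by (rule empty[rotated]) simp
next
  case (insert e B)
  then obtain \<xi>1 where 1: "\<And>a. a \<in> H \<Longrightarrow> \<xi>1 a = \<xi> a" "character_on (int_vec.span (B \<union> H)) \<xi>1" by metis
  from character_extend_one[OF int_vec.subspace_span 1(2), of e] obtain \<xi>2 where
    2: "\<And>a. a \<in> int_vec.span (B \<union> H) \<Longrightarrow> \<xi>2 a = \<xi>1 a"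
       "character_on (int_vec.span (insert e (int_vec.span (B \<union> H)))) \<xi>2" by metis
  have "int_vec.span (insert e B \<union> H) \<subseteq> int_vec.span (insert e (int_vec.span (B \<union> H)))"
    by (intro int_vec.span_mono) (use int_vec.span_superset[of "B \<union> H"] in auto)
  then have "character_on (int_vec.span (insert e B \<union> H)) \<xi>2"
    using 2(2) unfolding character_on_def by blast
  moreover have "\<xi>2 a = \<xi> a" if "a \<in> H" for a
    using 1(1)[OF that] 2(1)[of a] that by (simp add: int_vec.span_base)
  ultimately show ?case using insert.prems by blast
qed

lemma int_subspace_axes:
  fixes S :: "(int^'n) set"
  assumes S: "int_vec.subspace S" and ax: "\<And>j. axis j 1 \<in> S"
  shows "S = UNIV"
proof -
  have "x \<in> S" for x
  proof -
    have "x = (\<Sum>j\<in>UNIV. (x $ j) *s axis j 1)"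
      by (simp add: vec_eq_iff axis_def if_distrib cong: if_cong)
    also have "\<dots> \<in> S" by (intro int_vec.subspace_sum[OF S] int_vec.subspace_scale[OF S] ax)
    finally show ?thesis .
  qed
  then show ?thesis by auto
qed

lemma fourier_mode_minus: "fourier_mode (- k) x = inverse (fourier_mode k x)"
  by (simp add: fourier_mode_def exp_minus)

text \<open>A proper subgroup misses some unit vector \<open>e\<close>. The trivial character of the subgroup extends to a
  character that is not \<open>1\<close> at \<open>e\<close>, then to all of \<open>\<int>\<^sup>3\<close>. The arguments of its values at the unit
  vectors are the coordinates of \<open>\<theta>\<close>.\<close>

lemma proper_subgroup_annihilator:
  fixes G :: "(int^3) set"
  assumes G: "int_vec.subspace G" "G \<noteq> UNIV"
  obtains \<theta> where "\<theta> \<notin> period_lattice" "\<And>g. g \<in> G \<Longrightarrow> fourier_mode g \<theta> = 1"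
proof -
  obtain j where j: "axis j 1 \<notin> G" using int_subspace_axes[OF G(1)] G(2) by blast
  have "character_on G (\<lambda>_. 1)" by (simp add: character_on_def)
  from character_extend_one[OF G(1) this, of "axis j 1"] j obtain \<xi>1 where
    1: "\<And>a. a \<in> G \<Longrightarrow> \<xi>1 a = 1" "character_on (int_vec.span (insert (axis j 1) G)) \<xi>1" "\<xi>1 (axis j 1) \<noteq> 1"
    by metis
  let ?H = "int_vec.span (insert (axis j 1) G)"
  let ?B = "range (\<lambda>i::3. axis i (1::int))"
  from character_extend_finite[OF _ int_vec.subspace_span 1(2), of ?B] obtain \<xi> where
    2: "\<And>a. a \<in> ?H \<Longrightarrow> \<xi> a = \<xi>1 a" "character_on (int_vec.span (?B \<union> ?H)) \<xi>" by auto
  have "int_vec.span (?B \<union> ?H) = UNIV"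
    by (rule int_subspace_axes) (auto intro: int_vec.span_base)
  with 2 have chr: "character_on UNIV \<xi>" by simp
  have \<xi>G: "\<xi> g = 1" if "g \<in> G" for g using that 1 2 by (simp add: int_vec.span_base)
  have \<xi>j: "\<xi> (axis j 1) \<noteq> 1" using 1 2 by (simp add: int_vec.span_base)
  define \<theta> :: "real^3" where "\<theta> = (\<chi> i. Arg (\<xi> (axis i 1)))"
  have ax: "\<xi> (axis i 1) = fourier_mode (axis i 1) \<theta>" for i
  proof -
    have "cmod (\<xi> (axis i 1)) = 1" using chr by (auto simp: character_on_def)
    then show ?thesis using Arg_eq[of "\<xi> (axis i 1)"] unfolding fourier_mode_def \<theta>_def by force
  qed
  have nz: "fourier_mode k \<theta> \<noteq> 0" for k by (simp add: fourier_mode_def)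
  have "{k. \<xi> k = fourier_mode k \<theta>} = UNIV"
  proof (rule int_subspace_axes[OF int_subspaceI])
    show "0 \<in> {k. \<xi> k = fourier_mode k \<theta>}"
      using character_on_0[OF chr] by (simp add: fourier_mode_def)
    show "a + b \<in> {k. \<xi> k = fourier_mode k \<theta>}"
      if "a \<in> {k. \<xi> k = fourier_mode k \<theta>}" "b \<in> {k. \<xi> k = fourier_mode k \<theta>}" for a b
      using that chr by (auto simp: character_on_def fourier_mode_add)
    show "- a \<in> {k. \<xi> k = fourier_mode k \<theta>}"
      if "a \<in> {k. \<xi> k = fourier_mode k \<theta>}" for a
      using that character_on_uminus[OF chr int_vec.subspace_UNIV] by (auto simp: fourier_mode_minus)
  qed (use ax in auto)
  then have eq: "\<xi> k = fourier_mode k \<theta>" for k by auto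
  show ?thesis
  proof (rule that)
    show "fourier_mode g \<theta> = 1" if "g \<in> G" for g using \<xi>G[OF that] eq by simp
    show "\<theta> \<notin> period_lattice"
    proof
      assume "\<theta> \<in> period_lattice"
      then obtain n where "\<theta> $ j = 2 * pi * of_int n" unfolding period_lattice_def by blast
      then have "fourier_mode (axis j 1) \<theta> = 1"
        unfolding fourier_mode_def by (subst exp_eq_1) auto
      then show False using \<xi>j eq by simp
    qed
  qed
qed

text \<open>A point \<open>\<theta>\<close> annihilates all sums \<open>a + a'\<close> of forcing frequencies exactly if \<open>exp (\<i> a \<cdot> \<theta>)\<close> is one
  and the same sign for all of them.\<close>

lemma pair_lattice_full_iff:
  assumes "K \<noteq> {}"
  shows "pair_lattice \<epsilon> K = UNIV \<longleftrightarrow>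
            \<not> (\<exists>\<theta>::real^3. \<exists>c\<in>{1, -1::complex}. \<theta> \<notin> period_lattice \<and>
                 (\<forall>k\<in>K. exp (\<i> * complex_of_real (freq_dot k \<theta>)) = c) \<and>
                 (\<epsilon> = 1 \<longrightarrow> c = 1))"
    (is "_ \<longleftrightarrow> \<not> ?bad")
proof
  assume full: "pair_lattice \<epsilon> K = UNIV"
  show "\<not> ?bad"
  proof
    assume ?bad
    then obtain \<theta> and c :: complex where c: "c = 1 \<or> c = -1" "\<theta> \<notin> period_lattice"
      "\<And>k. k \<in> K \<Longrightarrow> fourier_mode k \<theta> = c" "\<epsilon> = 1 \<Longrightarrow> c = 1"
      unfolding fourier_mode_def by auto
    have A: "fourier_mode a \<theta> = c" if "a \<in> forcing_freqs \<epsilon> K" for a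
      using that c by (auto simp: forcing_freqs_def fourier_mode_minus split: if_splits)
        (auto simp: fourier_mode_def)
    have "int_vec.subspace {g. fourier_mode g \<theta> = 1}"
      by (rule int_subspaceI) (auto simp: fourier_mode_add fourier_mode_minus, simp add: fourier_mode_def)
    moreover have "{k + k' | k k'. k \<in> forcing_freqs \<epsilon> K \<and> k' \<in> forcing_freqs \<epsilon> K} \<subseteq> {g. fourier_mode g \<theta> = 1}"
      using A c(1) by (auto simp: fourier_mode_add)
    ultimately have "pair_lattice \<epsilon> K \<subseteq> {g. fourier_mode g \<theta> = 1}"
      unfolding pair_lattice_def using int_vec.span_minimal by blast
    then have 1: "fourier_mode (axis j 1) \<theta> = 1" for j using full by auto
    have "\<exists>n::int. \<theta> $ j = 2 * pi * of_int n" for j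
      using 1[of j] unfolding fourier_mode_def exp_eq_1 by (auto simp: mult_ac)
    then show False using c(2) by (auto simp: period_lattice_def)
  qed
next
  assume nb: "\<not> ?bad"
  show "pair_lattice \<epsilon> K = UNIV"
  proof (rule ccontr)
    assume "pair_lattice \<epsilon> K \<noteq> UNIV"
    from proper_subgroup_annihilator[OF pair_lattice_subspace this] obtain \<theta> where
      th: "\<theta> \<notin> period_lattice" "\<And>g. g \<in> pair_lattice \<epsilon> K \<Longrightarrow> fourier_mode g \<theta> = 1" by metis
    have pr: "fourier_mode a \<theta> * fourier_mode b \<theta> = 1"
      if "a \<in> forcing_freqs \<epsilon> K" "b \<in> forcing_freqs \<epsilon> K" for a b
      using th(2)[OF pair_latticeI[OF that]] by (simp add: fourier_mode_add)
    obtain k0 where k0: "k0 \<in> K" using assms by auto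
    then have k0A: "k0 \<in> forcing_freqs \<epsilon> K" by (simp add: forcing_freqs_def)
    define c where "c = fourier_mode k0 \<theta>"
    have cc: "c * c = 1" using pr[OF k0A k0A] by (simp add: c_def)
    then have "c \<in> {1, -1}" by (simp add: square_eq_1_iff)
    moreover have eq: "fourier_mode a \<theta> = c" if "a \<in> forcing_freqs \<epsilon> K" for a
    proof -
      have "fourier_mode a \<theta> * c * c = c" using pr[OF that k0A] by (simp add: c_def)
      then show ?thesis using cc by (simp add: mult.assoc)
    qed
    moreover have "\<epsilon> = 1 \<longrightarrow> c = 1"
      using eq[of 0] by (auto simp: forcing_freqs_def fourier_mode_def)
    moreover have "\<forall>k\<in>K. exp (\<i> * complex_of_real (freq_dot k \<theta>)) = c"
      using eq unfolding fourier_mode_def forcing_freqs_def by blast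
    ultimately show False using nb th(1) by blast
  qed
qed

section \<open>Integration by parts for periodic functions\<close>

lemma fundamental_cube_iff: "x \<in> fundamental_cube \<longleftrightarrow> (\<forall>i. 0 \<le> x $ i \<and> x $ i \<le> 2 * pi)"
  by (simp add: fundamental_cube_def mem_box_cart)

lemma axis_period: "axis j (2 * pi) \<in> period_lattice"
  unfolding period_lattice_def
proof (rule CollectI, rule allI)
  fix i
  show "\<exists>n::int. axis j (2 * pi) $ i = 2 * pi * of_int n"
    by (rule exI[of _ "if i = j then 1 else 0"]) (simp add: axis_def)
qed

text \<open>Cutting the shifted cube along the face \<open>x\<^sub>j = 2\<pi>\<close> and moving the protruding slab back by one
  period reassembles the cube.\<close>

lemma integral_periodic_shift:
  fixes f :: "real^3 \<Rightarrow> real"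
  assumes cont: "continuous_on UNIV f" and per: "torus_periodic f" and t: "0 \<le> t" "t \<le> 2 * pi"
  shows "integral fundamental_cube (\<lambda>x. f (x + axis j t)) = integral fundamental_cube f"
proof -
  let ?b = "(\<chi> i. 2 * pi) :: real^3"
  let ?v = "axis j t :: real^3"
  let ?w = "axis j (2 * pi) :: real^3"
  have int: "f integrable_on cbox a b" for a b
    by (rule integrable_continuous) (rule continuous_on_subset[OF cont], simp)
  have ax: "axis j 1 \<in> (Basis :: (real^3) set)" by simp
  have dot: "x \<bullet> axis j 1 = x $ j" for x :: "real^3" by (simp add: inner_axis)
  have "integral fundamental_cube (\<lambda>x. f (x + ?v)) = integral (cbox ?v (?b + ?v)) f"
    using integral_shift_cbox_plus[of 0 ?b f ?v] by (simp add: fundamental_cube_def o_def add.commute)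
  also have "\<dots> = integral (cbox ?v (?b + ?v) \<inter> {x. x \<bullet> axis j 1 \<le> 2 * pi}) f +
      integral (cbox ?v (?b + ?v) \<inter> {x. x \<bullet> axis j 1 \<ge> 2 * pi}) f"
    by (rule integral_split[OF int ax])
  also have "cbox ?v (?b + ?v) \<inter> {x. x \<bullet> axis j 1 \<le> 2 * pi} = cbox 0 ?b \<inter> {x. x \<bullet> axis j 1 \<ge> t}"
    unfolding dot using t by (auto simp: mem_box_cart axis_def split: if_splits; smt (verit))
  also have "cbox ?v (?b + ?v) \<inter> {x. x \<bullet> axis j 1 \<ge> 2 * pi} = cbox (0 + ?w) ((\<chi> i. if i = j then t else 2 * pi) + ?w)"
    unfolding dot using t by (auto simp: mem_box_cart axis_def split: if_splits; smt (verit))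
  also have "integral (cbox (0 + ?w) ((\<chi> i. if i = j then t else 2 * pi) + ?w)) f
      = integral (cbox 0 (\<chi> i. if i = j then t else 2 * pi)) (f \<circ> (+) ?w)"
    by (rule integral_shift_cbox_plus[symmetric])
  also have "f \<circ> (+) ?w = f"
    using per axis_period[of j] by (auto simp: torus_periodic_def add.commute)
  also have "cbox 0 (\<chi> i. if i = j then t else 2 * pi) = cbox 0 ?b \<inter> {x. x \<bullet> axis j 1 \<le> t}"
    unfolding dot using t by (auto simp: mem_box_cart split: if_splits; smt (verit))
  also have "integral (cbox 0 ?b \<inter> {x. x \<bullet> axis j 1 \<ge> t}) f + integral (cbox 0 ?b \<inter> {x. x \<bullet> axis j 1 \<le> t}) f
     = integral (cbox 0 ?b) f"
    using integral_split[OF int ax, of 0 ?b t] by simp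
  finally show ?thesis by (simp add: fundamental_cube_def)
qed

lemma has_derivative_along_axis:
  assumes "f differentiable (at (x + axis j t))"
  shows "((\<lambda>t. f (x + axis j t)) has_vector_derivative partial_deriv j f (x + axis j t)) (at t within U)"
proof -
  have f: "(f has_derivative frechet_derivative f (at (x + axis j t))) (at (x + axis j t))"
    using assms frechet_derivative_works by blast
  have ax: "(\<lambda>t. x + axis j t) = (\<lambda>t. x + t *\<^sub>R axis j (1::real))"
    by (auto simp: vec_eq_iff axis_def)
  have g: "((\<lambda>t. x + axis j t) has_derivative (\<lambda>s. s *\<^sub>R axis j 1)) (at t within U)"
    unfolding ax by (auto intro!: derivative_eq_intros)
  have "((\<lambda>t. f (x + axis j t)) has_derivative (\<lambda>s. frechet_derivative f (at (x + axis j t)) (s *\<^sub>R axis j 1))) (at t within U)"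
    using has_derivative_compose[OF g f] .
  moreover have "frechet_derivative f (at (x + axis j t)) (s *\<^sub>R axis j 1) =
      s *\<^sub>R frechet_derivative f (at (x + axis j t)) (axis j 1)" for s
    using has_derivative_linear[OF f] linear_scale by blast
  ultimately show ?thesis by (simp add: has_vector_derivative_def partial_deriv_def)
qed

lemma differentiable_continuous_UNIV:
  fixes f :: "real^3 \<Rightarrow> real"
  shows "(\<And>x. f differentiable (at x)) \<Longrightarrow> continuous_on UNIV f"
  by (meson continuous_at_imp_continuous_on differentiable_imp_continuous_within)

text \<open>The integral over the cube shifted by \<open>t\<close> in direction \<open>j\<close> is constant in \<open>t\<close>, and its derivative at
  \<open>t = 0\<close> is the integral of the partial derivative.\<close>

lemma integral_partial_deriv_periodic:
  assumes diff: "\<And>x. f differentiable (at x)" and cont: "continuous_on UNIV (partial_deriv j f)"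
    and per: "torus_periodic f"
  shows "integral fundamental_cube (partial_deriv j f) = 0"
proof -
  have cf: "continuous_on UNIV f"
    using diff by (rule differentiable_continuous_UNIV)
  let ?I = "\<lambda>t. integral fundamental_cube (\<lambda>x. f (x + axis j t))"
  have ax0: "axis j 0 = (0::real^3)" by (simp add: vec_eq_iff axis_def)
  have "continuous_on UNIV (axis j :: real \<Rightarrow> real^3)"
  proof -
    have "axis j = (\<lambda>s::real. s *\<^sub>R axis j (1::real) :: real^3)" by (auto simp: vec_eq_iff axis_def)
    then show ?thesis by (rule ssubst) (intro continuous_intros)
  qed
  note cax = continuous_on_compose2[OF this]
  have "(?I has_vector_derivative integral fundamental_cube (\<lambda>x. partial_deriv j f (x + axis j 0))) (at 0 within {0..2*pi})"
    unfolding fundamental_cube_def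
  proof (rule leibniz_rule_vector_derivative)
    show "(\<lambda>x. f (x + axis j t)) integrable_on cbox 0 (\<chi> j. 2 * pi)" for t
      by (intro integrable_continuous continuous_on_compose2[OF cf] continuous_intros) auto
    show "continuous_on ({0..2 * pi} \<times> cbox 0 (\<chi> j. 2 * pi)) (\<lambda>(t, x). partial_deriv j f (x + axis j t))"
      unfolding split_beta
      by (intro continuous_on_compose2[OF cont] continuous_intros cax) auto
  qed (auto intro!: has_derivative_along_axis diff)
  moreover have "(?I has_vector_derivative 0) (at 0 within {0..2*pi})"
    by (rule has_vector_derivative_transform[OF _ _ has_vector_derivative_const[of "integral fundamental_cube f"]])
      (auto simp: integral_periodic_shift[OF cf per])
  ultimately have "integral fundamental_cube (\<lambda>x. partial_deriv j f (x + axis j 0)) = 0"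
    by (rule vector_derivative_unique_within[rotated]) (simp add: trivial_limit_within islimpt_Icc)
  then show ?thesis by (simp add: ax0)
qed

lemma partial_deriv_mult:
  assumes "f differentiable (at x)" "g differentiable (at x)"
  shows "partial_deriv j (\<lambda>x. f x * g x) x = f x * partial_deriv j g x + partial_deriv j f x * g x"
  unfolding partial_deriv_def
  using frechet_derivative_at[OF has_derivative_mult[OF assms[unfolded frechet_derivative_works]], symmetric]
  by simp

lemma torus_periodic_mult: "torus_periodic f \<Longrightarrow> torus_periodic g \<Longrightarrow> torus_periodic (\<lambda>x. f x * g x)"
  by (simp add: torus_periodic_def)

lemma freq_dot_has_derivative: "(freq_dot k has_derivative freq_dot k) (at x)"
proof -
  have "bounded_linear (freq_dot k)" unfolding freq_dot_def by (rule bounded_linear_inner_right)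
  then show ?thesis by (rule bounded_linear_imp_has_derivative)
qed

lemma freq_dot_period:
  assumes "p \<in> period_lattice"
  obtains n :: int where "freq_dot k p = 2 * pi * of_int n"
proof -
  from assms obtain n :: "3 \<Rightarrow> int" where n: "\<And>j. p $ j = 2 * pi * of_int (n j)"
    unfolding period_lattice_def mem_Collect_eq by metis
  have "freq_dot k p = 2 * pi * of_int (\<Sum>j\<in>UNIV. k $ j * n j)"
    by (simp add: freq_dot_def inner_vec_def n sum_distrib_left mult_ac)
  then show ?thesis using that by blast
qed

lemma harmonic_periodic:
  "torus_periodic (\<lambda>x. cos (freq_dot k x))" "torus_periodic (\<lambda>x. sin (freq_dot k x))"
  unfolding torus_periodic_def
proof safe
  fix x p assume "p \<in> period_lattice"
  then obtain n :: int where "freq_dot k p = 2 * pi * of_int n" using freq_dot_period by blast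
  then have "freq_dot k (x + p) = freq_dot k x + 2 * pi * of_int n" by simp
  then show "cos (freq_dot k (x + p)) = cos (freq_dot k x)" "sin (freq_dot k (x + p)) = sin (freq_dot k x)"
    by (simp_all add: cos_add sin_add)
qed

lemma harmonic_has_derivative:
  "((\<lambda>x. cos (freq_dot k x)) has_derivative (\<lambda>h. - sin (freq_dot k x) * freq_dot k h)) (at x)"
  "((\<lambda>x. sin (freq_dot k x)) has_derivative (\<lambda>h. cos (freq_dot k x) * freq_dot k h)) (at x)"
  by (auto intro!: derivative_eq_intros freq_dot_has_derivative simp: fun_eq_iff)

lemma harmonic_partial_deriv:
  "partial_deriv j (\<lambda>x. cos (freq_dot k x)) x = - of_int (k $ j) * sin (freq_dot k x)"
  "partial_deriv j (\<lambda>x. sin (freq_dot k x)) x = of_int (k $ j) * cos (freq_dot k x)"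
  unfolding partial_deriv_def
  by (simp_all add: frechet_derivative_at[OF harmonic_has_derivative(1), symmetric]
     frechet_derivative_at[OF harmonic_has_derivative(2), symmetric])

lemma partial_deriv_linear:
  assumes "f differentiable (at x)" "g differentiable (at x)"
  shows "(fscale c f + g) differentiable (at x)"
    "partial_deriv j (fscale c f + g) x = c * partial_deriv j f x + partial_deriv j g x"
proof -
  have "((\<lambda>x. c * f x + g x) has_derivative (\<lambda>h. c * frechet_derivative f (at x) h + frechet_derivative g (at x) h)) (at x)"
    by (intro has_derivative_add has_derivative_mult_right) (use assms frechet_derivative_works in blast)+
  then have D: "((fscale c f + g) has_derivative (\<lambda>h. c * frechet_derivative f (at x) h + frechet_derivative g (at x) h)) (at x)"
    by (simp add: fscale_def plus_fun_def)
  then show "(fscale c f + g) differentiable (at x)" by (auto simp: differentiable_def)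
  show "partial_deriv j (fscale c f + g) x = c * partial_deriv j f x + partial_deriv j g x"
    unfolding partial_deriv_def using frechet_derivative_at[OF D, symmetric] by simp
qed

text \<open>The frequency set \<open>F\<close> is preserved by differentiation; the density argument in \<open>H\<^sup>1\<close> depends on
  this.\<close>

lemma harmonic_span_diff:
  assumes "f \<in> fun_module.span (harmonics F)"
  shows "torus_periodic f \<and> (\<forall>x. f differentiable (at x)) \<and>
    (\<forall>j. partial_deriv j f \<in> fun_module.span (harmonics F))"
  using assms
proof (induction rule: fun_module.span_induct_alt)
  case base
  have "partial_deriv j 0 = 0" for j
    by (auto simp: partial_deriv_def zero_fun_def)
  then show ?case using fun_module.span_zero
    by (auto simp: torus_periodic_def zero_fun_def)
next
  case (step c x y)
  have x: "torus_periodic x \<and> (\<forall>t. x differentiable (at t)) \<and>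
    (\<forall>j. partial_deriv j x \<in> fun_module.span (harmonics F))"
  proof -
    from step(1) consider k where "k \<in> F" "x = (\<lambda>x. cos (freq_dot k x))"
      | k where "k \<in> F" "x = (\<lambda>x. sin (freq_dot k x))"
      by (auto simp: harmonics_def)
    then show ?thesis
    proof cases
      case (1 k)
      have "partial_deriv j x = fscale (- of_int (k $ j)) (\<lambda>x. sin (freq_dot k x))" for j
        unfolding 1 by (auto simp: fscale_def harmonic_partial_deriv)
      moreover have "fscale (- of_int (k $ j)) (\<lambda>x. sin (freq_dot k x)) \<in> fun_module.span (harmonics F)" for j
        by (intro fun_module.span_scale fun_module.span_base) (use 1 in \<open>auto simp: harmonics_def\<close>)
      ultimately show ?thesis
        using harmonic_periodic harmonic_has_derivative unfolding 1 differentiable_def by metis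
    next
      case (2 k)
      have "partial_deriv j x = fscale (of_int (k $ j)) (\<lambda>x. cos (freq_dot k x))" for j
        unfolding 2 by (auto simp: fscale_def harmonic_partial_deriv)
      moreover have "fscale (of_int (k $ j)) (\<lambda>x. cos (freq_dot k x)) \<in> fun_module.span (harmonics F)" for j
        by (intro fun_module.span_scale fun_module.span_base) (use 2 in \<open>auto simp: harmonics_def\<close>)
      ultimately show ?thesis
        using harmonic_periodic harmonic_has_derivative unfolding 2 differentiable_def by metis
    qed
  qed
  have "partial_deriv j (fscale c x + y) = fscale c (partial_deriv j x) + partial_deriv j y" for j
    using x step(2) by (intro ext) (simp add: partial_deriv_linear(2), simp add: fscale_def)
  moreover have "torus_periodic (fscale c x + y)"
    using x step(2) by (simp add: torus_periodic_def fscale_def)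
  ultimately show ?case using x step(2) partial_deriv_linear(1)
    by (metis fun_module.span_add fun_module.span_scale)
qed

lemma harmonic_span_smooth:
  assumes "f \<in> fun_module.span (harmonics F)"
  shows "torus_smooth f"
proof -
  have "foldr partial_deriv js f \<in> fun_module.span (harmonics F)" for js
    by (induction js) (use assms harmonic_span_diff in auto)
  then show ?thesis using assms harmonic_span_diff unfolding torus_smooth_def by blast
qed

lemma torus_smooth_facts:
  assumes "torus_smooth \<phi>"
  shows "torus_periodic \<phi>" "\<And>x. \<phi> differentiable (at x)" "continuous_on UNIV \<phi>"
    "continuous_on UNIV (partial_deriv j \<phi>)"
proof -
  have *: "foldr partial_deriv js \<phi> differentiable (at x)" for js x
    using assms by (simp add: torus_smooth_def)
  show "torus_periodic \<phi>" using assms by (simp add: torus_smooth_def)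
  show d: "\<phi> differentiable (at x)" for x using *[of "[]"] by simp
  have d': "partial_deriv j \<phi> differentiable (at x)" for x using *[of "[j]"] by simp
  show "continuous_on UNIV \<phi>" "continuous_on UNIV (partial_deriv j \<phi>)"
    by (rule differentiable_continuous_UNIV, fact d, rule differentiable_continuous_UNIV, fact d')
qed

section \<open>Square-integrable functions on the torus and orthogonal projection\<close>

text \<open>Integration over the cube as a measure of its own, so that square-integrability and the inner
  product do not carry indicator functions.\<close>

definition torus_measure :: "(real^3) measure" where
  "torus_measure = restrict_space lborel fundamental_cube"

definition square_integrable :: "(real^3 \<Rightarrow> real) set" where
  "square_integrable = {f. f \<in> borel_measurable torus_measure \<and> integrable torus_measure (\<lambda>x. (f x)\<^sup>2)}"

definition L2_inner :: "(real^3 \<Rightarrow> real) \<Rightarrow> (real^3 \<Rightarrow> real) \<Rightarrow> real" where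
  "L2_inner f g = (LINT x|torus_measure. f x * g x)"

lemma fundamental_cube_sets [measurable, simp]: "fundamental_cube \<in> sets borel"
  by (simp add: fundamental_cube_def)

lemma space_torus_measure [simp]: "space torus_measure = fundamental_cube"
  by (simp add: torus_measure_def space_restrict_space)

lemma set_integral_torus: "(LINT x:fundamental_cube|lborel. f x) = (LINT x|torus_measure. f x)"
  for f :: "real^3 \<Rightarrow> real"
  by (simp add: set_lebesgue_integral_def torus_measure_def integral_restrict_space)

lemma set_integrable_torus: "set_integrable lborel fundamental_cube f \<longleftrightarrow> integrable torus_measure f"
  for f :: "real^3 \<Rightarrow> real"
  by (simp add: set_integrable_def torus_measure_def integrable_restrict_space)

lemma torus_L2_square_integrable: "f \<in> torus_L2 \<Longrightarrow> f \<in> square_integrable"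
  unfolding torus_L2_def square_integrable_def set_integrable_torus
  by (auto simp: torus_measure_def intro!: measurable_restrict_space1)

lemma continuous_torus_integral:
  fixes f :: "real^3 \<Rightarrow> real"
  assumes "continuous_on UNIV f"
  shows "integrable torus_measure f" "(LINT x|torus_measure. f x) = integral fundamental_cube f"
proof -
  have "set_integrable lborel fundamental_cube f"
    unfolding set_integrable_def fundamental_cube_def
    by (rule borel_integrable_compact[OF compact_cbox continuous_on_subset[OF assms]]) simp
  then show "integrable torus_measure f" "(LINT x|torus_measure. f x) = integral fundamental_cube f"
    using set_borel_integral_eq_integral[of fundamental_cube f]
    by (simp_all add: set_integrable_torus set_integral_torus)
qed

lemma continuous_borel_measurable_torus:
  "continuous_on UNIV f \<Longrightarrow> f \<in> borel_measurable torus_measure" for f :: "real^3 \<Rightarrow> real"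
  unfolding torus_measure_def by (intro measurable_restrict_space1) (simp add: borel_measurable_continuous_onI)

lemma continuous_square_integrable: "continuous_on UNIV f \<Longrightarrow> f \<in> square_integrable"
  unfolding square_integrable_def
  by (auto intro!: continuous_torus_integral continuous_borel_measurable_torus continuous_intros)

lemma continuous_torus_L2: "continuous_on UNIV f \<Longrightarrow> torus_periodic f \<Longrightarrow> f \<in> torus_L2"
  unfolding torus_L2_def set_integrable_torus
  by (auto intro!: continuous_torus_integral borel_measurable_continuous_onI continuous_intros)

lemma square_integrable_mult:
  assumes "f \<in> square_integrable" "g \<in> square_integrable"
  shows "integrable torus_measure (\<lambda>x. f x * g x)"
proof (rule Bochner_Integration.integrable_bound)
  show "integrable torus_measure (\<lambda>x. (f x)\<^sup>2 + (g x)\<^sup>2)"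
    using assms by (auto simp: square_integrable_def)
  show "(\<lambda>x. f x * g x) \<in> borel_measurable torus_measure"
    using assms by (auto simp: square_integrable_def)
  have "\<bar>a * b\<bar> \<le> a\<^sup>2 + b\<^sup>2" for a b :: real
  proof -
    have "2 * (\<bar>a\<bar> * \<bar>b\<bar>) \<le> a\<^sup>2 + b\<^sup>2"
      using sum_squares_bound[of "\<bar>a\<bar>" "\<bar>b\<bar>"] by simp
    moreover have "0 \<le> \<bar>a\<bar> * \<bar>b\<bar>" by simp
    ultimately show ?thesis by (simp only: abs_mult)
  qed
  then show "AE x in torus_measure. norm (f x * g x) \<le> norm ((f x)\<^sup>2 + (g x)\<^sup>2)" by simp
qed

lemma square_integrable_subspace: "fun_module.subspace square_integrable"
proof (rule fun_module.subspaceI)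
  show "0 \<in> square_integrable" by (simp add: square_integrable_def zero_fun_def)
next
  fix f g assume fg: "f \<in> square_integrable" "g \<in> square_integrable"
  have "(\<lambda>x. ((f + g) x)\<^sup>2) = (\<lambda>x. (f x)\<^sup>2 + (g x)\<^sup>2 + 2 * (f x * g x))"
    by (simp add: power2_sum mult.assoc)
  moreover have "integrable torus_measure (\<lambda>x. (f x)\<^sup>2 + (g x)\<^sup>2 + 2 * (f x * g x))"
    by (intro Bochner_Integration.integrable_add integrable_mult_right square_integrable_mult)
      (use fg in \<open>auto simp: square_integrable_def\<close>)
  moreover have "(\<lambda>x. f x + g x) \<in> borel_measurable torus_measure"
    using fg by (auto simp: square_integrable_def)
  ultimately show "f + g \<in> square_integrable" by (simp add: square_integrable_def plus_fun_def)
next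
  fix c and f :: "real^3 \<Rightarrow> real" assume f: "f \<in> square_integrable"
  then show "fscale c f \<in> square_integrable"
    by (auto simp: square_integrable_def fscale_def power_mult_distrib)
qed

lemmas square_integrable_add = fun_module.subspace_add[OF square_integrable_subspace]
lemmas square_integrable_diff = fun_module.subspace_diff[OF square_integrable_subspace]
lemmas square_integrable_scale = fun_module.subspace_scale[OF square_integrable_subspace]

lemma L2_inner_commute: "L2_inner f g = L2_inner g f"
  by (simp add: L2_inner_def mult.commute)

lemma L2_inner_add_left:
  assumes "f \<in> square_integrable" "g \<in> square_integrable" "h \<in> square_integrable"
  shows "L2_inner (f + g) h = L2_inner f h + L2_inner g h"
  by (simp add: L2_inner_def distrib_right square_integrable_mult assms)

lemma L2_inner_diff_left:
  assumes "f \<in> square_integrable" "g \<in> square_integrable" "h \<in> square_integrable"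
  shows "L2_inner (f - g) h = L2_inner f h - L2_inner g h"
  by (simp add: L2_inner_def left_diff_distrib square_integrable_mult assms)

lemma L2_inner_scale_left: "L2_inner (fscale c f) h = c * L2_inner f h"
  by (simp add: L2_inner_def fscale_def mult.assoc)

lemma L2_inner_add_right:
  assumes "f \<in> square_integrable" "g \<in> square_integrable" "h \<in> square_integrable"
  shows "L2_inner h (f + g) = L2_inner h f + L2_inner h g"
  using L2_inner_add_left[OF assms] by (simp add: L2_inner_commute)

lemma L2_inner_diff_right:
  assumes "f \<in> square_integrable" "g \<in> square_integrable" "h \<in> square_integrable"
  shows "L2_inner h (f - g) = L2_inner h f - L2_inner h g"
  using L2_inner_diff_left[OF assms] by (simp add: L2_inner_commute)

lemma L2_inner_scale_right: "L2_inner h (fscale c f) = c * L2_inner h f"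
  using L2_inner_scale_left[of c f h] by (simp add: L2_inner_commute)

lemma L2_inner_nonneg: "L2_inner f f \<ge> 0"
  by (simp add: L2_inner_def)

lemma L2_inner_self: "L2_inner f f = (LINT x|torus_measure. (f x)\<^sup>2)"
  by (simp add: L2_inner_def power2_eq_square)

lemma L2_norm_sum_le:
  assumes "f \<in> square_integrable" "g \<in> square_integrable"
  shows "L2_inner (f + g) (f + g) \<le> 2 * L2_inner f f + 2 * L2_inner g g"
  using L2_inner_nonneg[of "f - g"] assms
  by (simp add: L2_inner_add_left L2_inner_add_right L2_inner_diff_left L2_inner_diff_right
      square_integrable_add square_integrable_diff)

lemma L2_inner_null:
  assumes "f \<in> square_integrable" "L2_inner f f = 0"
  shows "AE x in torus_measure. f x = 0"
  using assms integral_nonneg_eq_0_iff_AE[of torus_measure "\<lambda>x. (f x)\<^sup>2"]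
  by (simp add: L2_inner_self square_integrable_def)

lemma L2_orthogonal_span:
  assumes f: "f \<in> square_integrable" and B: "B \<subseteq> square_integrable"
    and orth: "\<And>b. b \<in> B \<Longrightarrow> L2_inner f b = 0" and g: "g \<in> fun_module.span B"
  shows "L2_inner f g = 0"
proof -
  have "g \<in> square_integrable \<and> L2_inner f g = 0"
    using g
  proof (induction rule: fun_module.span_induct_alt)
    case base
    then show ?case by (simp add: L2_inner_def square_integrable_def zero_fun_def)
  next
    case (step c x y)
    then have "x \<in> square_integrable" "L2_inner f x = 0" using B orth by auto
    with step(2) f show ?case
      by (simp only: L2_inner_add_right L2_inner_scale_right square_integrable_add square_integrable_scale) simp
  qed
  then show ?thesis by simp
qed

text \<open>Gram-Schmidt: the residual of the new generator \<open>b\<close> after projection onto the span of the others is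
  the direction \<open>d\<close> in which the projection of \<open>u\<close> is corrected.\<close>

lemma L2_projection_exists:
  assumes "finite B" "B \<subseteq> square_integrable" "u \<in> square_integrable"
  obtains P where "P \<in> fun_module.span B" "\<And>b. b \<in> B \<Longrightarrow> L2_inner (u - P) b = 0"
  using assms
proof (induction B arbitrary: u thesis rule: finite_induct)
  case empty
  then show ?case using fun_module.span_zero by blast
next
  case (insert b B)
  have b: "b \<in> square_integrable" and B: "B \<subseteq> square_integrable" and u: "u \<in> square_integrable"
    using insert.prems by auto
  have sq: "f \<in> square_integrable" if "f \<in> fun_module.span B" for f
    using that fun_module.span_minimal[OF B square_integrable_subspace] by blast
  have mono: "f \<in> fun_module.span (insert b B)" if "f \<in> fun_module.span B" for f
    using that fun_module.span_mono[of B "insert b B"] by blast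
  obtain P where P: "P \<in> fun_module.span B" "\<And>b. b \<in> B \<Longrightarrow> L2_inner (u - P) b = 0"
    using insert.IH[OF _ B u] by blast
  obtain Q where Q: "Q \<in> fun_module.span B" "\<And>b'. b' \<in> B \<Longrightarrow> L2_inner (b - Q) b' = 0"
    using insert.IH[OF _ B b] by blast
  define d where "d = b - Q"
  define t where "t = L2_inner (u - P) d / L2_inner d d"
  note sP = sq[OF P(1)] and sQ = sq[OF Q(1)]
  have sd: "d \<in> square_integrable" and suP: "u - P \<in> square_integrable"
    unfolding d_def using square_integrable_diff b u sP sQ by auto
  have dQ: "L2_inner d Q = 0" unfolding d_def
    by (rule L2_orthogonal_span[OF _ B Q(2) Q(1)]) (use sd d_def in auto)
  have PQ: "L2_inner (u - P) Q = 0"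
    by (rule L2_orthogonal_span[OF suP B P(2) Q(1)])
  \<comment> \<open>If \<open>d\<close> vanishes almost everywhere, both sides are zero, whatever \<open>t\<close> is.\<close>
  have td: "t * L2_inner d d = L2_inner (u - P) d"
  proof (cases "L2_inner d d = 0")
    case True
    then have "AE x in torus_measure. (u - P) x * d x = 0"
      using L2_inner_null[OF sd] by auto
    then have "L2_inner (u - P) d = (LINT x|torus_measure. 0)"
      unfolding L2_inner_def using suP sd
      by (intro integral_cong_AE) (auto simp: square_integrable_def fun_diff_def)
    then show ?thesis using True by simp
  qed (simp add: t_def)
  have st: "fscale t d \<in> square_integrable" using sd by (rule square_integrable_scale)
  have b_eq: "b = d + Q" by (simp add: d_def)
  have e: "u - (P + fscale t d) = (u - P) - fscale t d" by (simp add: algebra_simps)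
  show ?case
  proof (rule insert.prems(1))
    have "d \<in> fun_module.span (insert b B)" unfolding d_def
      by (intro fun_module.span_diff mono Q(1) fun_module.span_base) simp
    then show "P + fscale t d \<in> fun_module.span (insert b B)"
      by (rule fun_module.span_add[OF mono[OF P(1)] fun_module.span_scale])
    fix b' assume "b' \<in> insert b B"
    then consider "b' = b" | "b' \<in> B" by auto
    then show "L2_inner (u - (P + fscale t d)) b' = 0"
    proof cases
      case 1
      show ?thesis unfolding 1 e unfolding b_eq
        using suP st sd sQ td dQ PQ
        by (simp add: L2_inner_diff_left L2_inner_add_right L2_inner_scale_left square_integrable_add)
    next
      case 2
      then have "b' \<in> square_integrable" using B by auto
      then show ?thesis unfolding e using suP st P(2)[OF 2] Q(2)[OF 2]
        by (simp add: L2_inner_diff_left L2_inner_scale_left d_def)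
    qed
  qed
qed

text \<open>By Pythagoras, since \<open>P - Q\<close> lies in the span.\<close>

lemma L2_projection_best:
  assumes B: "B \<subseteq> square_integrable" and u: "u \<in> square_integrable"
    and P: "P \<in> fun_module.span B" "\<And>b. b \<in> B \<Longrightarrow> L2_inner (u - P) b = 0"
    and Q: "Q \<in> fun_module.span B"
  shows "L2_inner (u - P) (u - P) \<le> L2_inner (u - Q) (u - Q)"
proof -
  have sq: "f \<in> square_integrable" if "f \<in> fun_module.span B" for f
    using that fun_module.span_minimal[OF B square_integrable_subspace] by blast
  have PQ: "P - Q \<in> fun_module.span B" using P Q by (intro fun_module.span_diff)
  have s: "u - P \<in> square_integrable" using square_integrable_diff[OF u sq[OF P(1)]] .
  have "L2_inner (u - P) (P - Q) = 0" using L2_orthogonal_span[OF s B P(2) PQ] .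
  moreover have "u - Q = (u - P) + (P - Q)" by simp
  ultimately have "L2_inner (u - Q) (u - Q) = L2_inner (u - P) (u - P) + L2_inner (P - Q) (P - Q)"
    using s sq[OF PQ]
    by (simp only: L2_inner_add_left L2_inner_add_right square_integrable_add L2_inner_commute[of "P - Q" "u - P"])
  then show ?thesis using L2_inner_nonneg[of "P - Q"] by simp
qed

section \<open>Density of trigonometric polynomials in the square-integrable functions\<close>

text \<open>Approximability by trigonometric polynomials in the norm of \<open>L\<^sup>2\<close>. It is treated as a property that
  is stable under linear combinations and dominated limits, so that it can be extended step by step
  to larger classes of functions.\<close>

definition trig_approximable :: "(real^3 \<Rightarrow> real) \<Rightarrow> bool" where
  "trig_approximable f \<longleftrightarrow> f \<in> square_integrable \<and>
     (\<forall>e>0. \<exists>P\<in>fun_module.span (harmonics UNIV). L2_inner (f - P) (f - P) < e)"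

lemma harmonic_span_continuous: "f \<in> fun_module.span (harmonics F) \<Longrightarrow> continuous_on UNIV f"
  using harmonic_span_diff differentiable_continuous_UNIV by blast

lemma harmonic_span_square_integrable: "f \<in> fun_module.span (harmonics F) \<Longrightarrow> f \<in> square_integrable"
  using harmonic_span_continuous continuous_square_integrable by blast

lemma harmonics_square_integrable: "harmonics F \<subseteq> square_integrable"
  using harmonic_span_square_integrable fun_module.span_base by blast

lemma trig_approximable_limit:
  assumes f: "f \<in> square_integrable"
    and ap: "\<And>e. e > 0 \<Longrightarrow> \<exists>g. trig_approximable g \<and> L2_inner (f - g) (f - g) < e"
  shows "trig_approximable f"
  unfolding trig_approximable_def
proof (intro conjI f allI impI)
  fix e :: real assume e: "e > 0"
  \<comment> \<open>The factor \<open>4\<close> compensates the constants \<open>2\<close> in \<open>L2_norm_sum_le\<close>.\<close>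
  obtain g where g: "trig_approximable g" "L2_inner (f - g) (f - g) < e / 4"
    using ap[of "e / 4"] e by auto
  obtain P where P: "P \<in> fun_module.span (harmonics UNIV)" "L2_inner (g - P) (g - P) < e / 4"
    using g(1) e unfolding trig_approximable_def by (meson divide_pos_pos zero_less_numeral)
  have gs: "g \<in> square_integrable" using g(1) by (simp add: trig_approximable_def)
  have "f - P = (f - g) + (g - P)" by simp
  then have "L2_inner (f - P) (f - P) \<le> 2 * L2_inner (f - g) (f - g) + 2 * L2_inner (g - P) (g - P)"
    using L2_norm_sum_le[of "f - g" "g - P"] f gs harmonic_span_square_integrable[OF P(1)]
    by (simp add: square_integrable_diff)
  then show "\<exists>P\<in>fun_module.span (harmonics UNIV). L2_inner (f - P) (f - P) < e"
    using g(2) P by (intro bexI[of _ P]) auto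
qed

lemma trig_approximable_add:
  assumes f: "trig_approximable f" and g: "trig_approximable g"
  shows "trig_approximable (f + g)"
  unfolding trig_approximable_def
proof (intro conjI allI impI)
  have s: "f \<in> square_integrable" "g \<in> square_integrable" using f g by (simp_all add: trig_approximable_def)
  then show "f + g \<in> square_integrable" by (rule square_integrable_add)
  fix e :: real assume e: "e > 0"
  obtain P Q where P: "P \<in> fun_module.span (harmonics UNIV)" "L2_inner (f - P) (f - P) < e / 4"
    and Q: "Q \<in> fun_module.span (harmonics UNIV)" "L2_inner (g - Q) (g - Q) < e / 4"
    using f g e unfolding trig_approximable_def by (meson divide_pos_pos zero_less_numeral)
  have "(f + g) - (P + Q) = (f - P) + (g - Q)" by simp
  then have "L2_inner ((f + g) - (P + Q)) ((f + g) - (P + Q)) \<le> 2 * L2_inner (f - P) (f - P) + 2 * L2_inner (g - Q) (g - Q)"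
    using L2_norm_sum_le[OF square_integrable_diff square_integrable_diff, OF s(1) _ s(2)]
      harmonic_span_square_integrable P(1) Q(1) by (simp only:)
  then show "\<exists>P\<in>fun_module.span (harmonics UNIV). L2_inner (f + g - P) (f + g - P) < e"
    using P Q by (intro bexI[of _ "P + Q"] fun_module.span_add) auto
qed

lemma trig_approximable_scale:
  assumes f: "trig_approximable f"
  shows "trig_approximable (fscale c f)"
proof (cases "c = 0")
  case True
  then have "fscale c f = 0" by (auto simp: fscale_def)
  then show ?thesis
    using fun_module.span_zero[of "harmonics UNIV"] fun_module.subspace_0[OF square_integrable_subspace]
    by (auto simp: trig_approximable_def L2_inner_def zero_fun_def intro!: bexI[of _ 0])
next
  case False
  show ?thesis unfolding trig_approximable_def
  proof (intro conjI allI impI)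
    show "fscale c f \<in> square_integrable"
      using f by (simp add: trig_approximable_def square_integrable_scale)
    fix e :: real assume e: "e > 0"
    then obtain P where P: "P \<in> fun_module.span (harmonics UNIV)" "L2_inner (f - P) (f - P) < e / c\<^sup>2"
      using f False unfolding trig_approximable_def by (meson divide_pos_pos zero_less_power2)
    have "fscale c f - fscale c P = fscale c (f - P)" by (auto simp: fscale_def algebra_simps)
    then have "L2_inner (fscale c f - fscale c P) (fscale c f - fscale c P) = c\<^sup>2 * L2_inner (f - P) (f - P)"
      by (simp add: L2_inner_scale_left L2_inner_scale_right power2_eq_square)
    also have "\<dots> < e" using P(2) False by (simp add: field_simps)
    finally show "\<exists>P\<in>fun_module.span (harmonics UNIV). L2_inner (fscale c f - P) (fscale c f - P) < e"
      using P(1) by (intro bexI[of _ "fscale c P"] fun_module.span_scale) auto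
  qed
qed

lemma trig_approximable_dominated:
  assumes s: "\<And>i::nat. trig_approximable (s i)"
    and f: "f \<in> borel_measurable torus_measure"
    and lim: "AE x in torus_measure. (\<lambda>i. s i x) \<longlonglongrightarrow> f x"
    and w: "w \<in> square_integrable" "\<And>i x. x \<in> fundamental_cube \<Longrightarrow> \<bar>s i x\<bar> \<le> w x"
  shows "trig_approximable f"
proof -
  have sm: "s i \<in> borel_measurable torus_measure" for i
    using s[of i] by (simp add: trig_approximable_def square_integrable_def)
  have wm: "w \<in> borel_measurable torus_measure" "integrable torus_measure (\<lambda>x. (w x)\<^sup>2)"
    using w(1) by (simp_all add: square_integrable_def)
  have fw: "AE x in torus_measure. \<bar>f x\<bar> \<le> w x"
    using lim AE_space
  proof eventually_elim
    case (elim x)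
    have "(\<lambda>i. \<bar>s i x\<bar>) \<longlonglongrightarrow> \<bar>f x\<bar>" using elim(1) by (rule tendsto_rabs)
    then show ?case by (rule LIMSEQ_le_const2) (use w(2) elim in auto)
  qed
  have fs: "f \<in> square_integrable"
    unfolding square_integrable_def
  proof (intro CollectI conjI f)
    show "integrable torus_measure (\<lambda>x. (f x)\<^sup>2)"
    proof (rule Bochner_Integration.integrable_bound[OF wm(2)])
      show "AE x in torus_measure. norm ((f x)\<^sup>2) \<le> norm ((w x)\<^sup>2)"
        using fw by eventually_elim (simp add: abs_le_square_iff[symmetric])
    qed (use f in measurable)
  qed
  have "(\<lambda>i. LINT x|torus_measure. (f x - s i x)\<^sup>2) \<longlonglongrightarrow> (LINT x|torus_measure. 0)"
  proof (rule integral_dominated_convergence[where w = "\<lambda>x. 4 * (w x)\<^sup>2"])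
    show "AE x in torus_measure. (\<lambda>i. (f x - s i x)\<^sup>2) \<longlonglongrightarrow> 0"
      using lim
    proof eventually_elim
      case (elim x)
      have "(\<lambda>i. (f x - s i x)\<^sup>2) \<longlonglongrightarrow> (f x - f x)\<^sup>2" by (intro tendsto_intros elim)
      then show ?case by simp
    qed
    fix i
    show "AE x in torus_measure. norm ((f x - s i x)\<^sup>2) \<le> 4 * (w x)\<^sup>2"
      using fw AE_space
    proof eventually_elim
      case (elim x)
      have "\<bar>f x - s i x\<bar> \<le> \<bar>2 * w x\<bar>" using elim w(2)[of x i] by auto
      then have "(f x - s i x)\<^sup>2 \<le> (2 * w x)\<^sup>2" by (rule abs_le_square_iff[THEN iffD1])
      then show ?case by (simp add: power_mult_distrib)
    qed
  qed (use f sm wm in auto)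
  then have lim0: "(\<lambda>i. L2_inner (f - s i) (f - s i)) \<longlonglongrightarrow> 0" by (simp add: L2_inner_self)
  show ?thesis
  proof (rule trig_approximable_limit[OF fs])
    fix e :: real assume "e > 0"
    then obtain i where "L2_inner (f - s i) (f - s i) < e"
      using order_tendstoD(2)[OF lim0] unfolding eventually_sequentially by blast
    then show "\<exists>g. trig_approximable g \<and> L2_inner (f - g) (f - g) < e" using s by blast
  qed
qed

text \<open>The torus as a compact subset of \<open>\<complex>\<^sup>3\<close>. Periodic functions do not separate the points of opposite
  faces of the cube, whereas the coordinates separate the points of the image.\<close>

definition torus_embedding :: "real^3 \<Rightarrow> complex^3" where
  "torus_embedding x = (\<chi> j. exp (\<i> * complex_of_real (x $ j)))"

lemma continuous_torus_embedding: "continuous_on A torus_embedding"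
  unfolding torus_embedding_def by (intro continuous_intros)

lemma compact_torus_image: "compact X \<Longrightarrow> compact (torus_embedding ` X)"
  by (intro compact_continuous_image continuous_torus_embedding)

text \<open>Only points of the faces of the cube are identified with other points, so it suffices that one of
  the two points is interior.\<close>

lemma torus_embedding_inj:
  assumes x: "x \<in> box 0 (\<chi> j. 2 * pi)" and y: "y \<in> fundamental_cube"
    and eq: "torus_embedding x = torus_embedding y"
  shows "x = y"
proof -
  have "x $ j = y $ j" for j
  proof -
    have "exp (\<i> * complex_of_real (x $ j)) = exp (\<i> * complex_of_real (y $ j))"
      using eq by (simp add: torus_embedding_def vec_eq_iff)
    then obtain n :: int where "\<i> * complex_of_real (x $ j) = \<i> * complex_of_real (y $ j) + complex_of_real (of_int (2 * n) * pi) * \<i>"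
      unfolding exp_eq by blast
    then have "\<i> * complex_of_real (x $ j) = \<i> * complex_of_real (y $ j + 2 * pi * of_int n)"
      by (simp add: algebra_simps)
    then have n: "x $ j = y $ j + 2 * pi * of_int n"
      by (metis mult_cancel_left complex_i_not_zero of_real_eq_iff)
    have b: "0 < x $ j" "x $ j < 2 * pi" "0 \<le> y $ j" "y $ j \<le> 2 * pi"
      using x y by (auto simp: mem_box_cart fundamental_cube_iff)
    have "2 * pi * of_int n < 2 * pi * 1" "2 * pi * (-1) < 2 * pi * real_of_int n" using n b by linarith+
    note this[THEN mult_left_less_imp_less]
    then have "real_of_int n < 1" "-1 < real_of_int n" by simp_all
    then have "n = 0" by linarith
    then show ?thesis using n by simp
  qed
  then show ?thesis by (simp add: vec_eq_iff)
qed

lemma harmonic_span_mult: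
  assumes "f \<in> fun_module.span (harmonics UNIV)" "g \<in> fun_module.span (harmonics UNIV)"
  shows "(\<lambda>x. f x * g x) \<in> fun_module.span (harmonics UNIV)"
proof (rule span_mult_image[OF assms])
  let ?V = "fun_module.span (harmonics UNIV)"
  let ?c = "\<lambda>k x. cos (freq_dot k x)" and ?s = "\<lambda>k x. sin (freq_dot k x)"
  have V: "fscale r a + fscale r' b \<in> ?V" if "a \<in> harmonics UNIV" "b \<in> harmonics UNIV" for r r' a b
    using that by (intro fun_module.span_add fun_module.span_scale fun_module.span_base)
  have h: "?c k \<in> harmonics UNIV" "?s k \<in> harmonics UNIV" for k by (auto simp: harmonics_def)
  have "(\<lambda>x. ?c k x * ?c l x) = fscale (1/2) (?c (k - l)) + fscale (1/2) (?c (k + l))" for k l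
    by (auto simp: fscale_def cos_times_cos field_simps)
  then have cc: "(\<lambda>x. ?c k x * ?c l x) \<in> ?V" for k l using V[OF h(1) h(1)] by (simp only:)
  have "(\<lambda>x. ?s k x * ?s l x) = fscale (1/2) (?c (k - l)) + fscale (-1/2) (?c (k + l))" for k l
    by (auto simp: fscale_def sin_times_sin field_simps)
  then have ss: "(\<lambda>x. ?s k x * ?s l x) \<in> ?V" for k l using V[OF h(1) h(1)] by (simp only:)
  have "(\<lambda>x. ?s k x * ?c l x) = fscale (1/2) (?s (k + l)) + fscale (1/2) (?s (k - l))" for k l
    by (rule ext) (simp add: fscale_def sin_times_cos add_divide_distrib)
  then have sc: "(\<lambda>x. ?s k x * ?c l x) \<in> ?V" for k l using V[OF h(2) h(2)] by (simp only:)
  have "(\<lambda>x. ?c k x * ?s l x) = (\<lambda>x. ?s l x * ?c k x)" for k l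
    by (simp add: mult.commute)
  then have cs: "(\<lambda>x. ?c k x * ?s l x) \<in> ?V" for k l using sc by (simp only:)
  have cases: "(\<exists>k. a = ?c k) \<or> (\<exists>k. a = ?s k)" if "a \<in> harmonics UNIV" for a
    using that by (auto simp: harmonics_def)
  fix a b assume "a \<in> harmonics UNIV" "b \<in> harmonics UNIV"
  from cases[OF this(1)] cases[OF this(2)] show "(\<lambda>x. a x * b x) \<in> ?V"
    by (elim disjE exE) (simp_all only: cc ss sc cs)
qed

lemma constant_harmonic_span: "(\<lambda>_. c) \<in> fun_module.span (harmonics UNIV)"
proof -
  have "(\<lambda>_. c) = fscale c (\<lambda>x. cos (freq_dot 0 x))" by (auto simp: fscale_def)
  moreover have "(\<lambda>x. cos (freq_dot 0 x)) \<in> harmonics UNIV"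
    unfolding harmonics_def by blast
  ultimately show ?thesis
    by (simp only: fun_module.span_base fun_module.span_scale)
qed

lemma trig_approximable_span:
  "f \<in> fun_module.span (harmonics UNIV) \<Longrightarrow> trig_approximable f"
  unfolding trig_approximable_def
  by (auto simp: L2_inner_def harmonic_span_square_integrable intro!: bexI[of _ f])

text \<open>The functions on the image whose pullbacks are trigonometric polynomials form an algebra, which
  contains the real and imaginary parts of the coordinates. The Stone-Weierstrass theorem applies.\<close>

lemma uniform_trig_approximation:
  assumes F: "continuous_on (torus_embedding ` fundamental_cube) F" and e: "e > 0"
  shows "\<exists>P\<in>fun_module.span (harmonics UNIV). \<forall>x\<in>fundamental_cube. \<bar>F (torus_embedding x) - P x\<bar> < e"
proof -
  let ?S = "torus_embedding ` fundamental_cube"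
  let ?V = "fun_module.span (harmonics UNIV)"
  define R where "R = {G. continuous_on ?S G \<and> (\<lambda>x. G (torus_embedding x)) \<in> ?V}"
  have "function_ring_on R ?S"
  proof
    show "compact ?S" unfolding fundamental_cube_def by (intro compact_torus_image compact_cbox)
    show "continuous_on ?S f" if "f \<in> R" for f using that by (simp add: R_def)
    show "(\<lambda>x. f x + g x) \<in> R" if "f \<in> R" "g \<in> R" for f g
      using that fun_module.span_add[of "\<lambda>x. f (torus_embedding x)" "harmonics UNIV" "\<lambda>x. g (torus_embedding x)"]
      by (auto simp: R_def plus_fun_def intro!: continuous_intros)
    show "(\<lambda>x. f x * g x) \<in> R" if "f \<in> R" "g \<in> R" for f g
      using that by (auto simp: R_def intro!: continuous_intros harmonic_span_mult)
    show "(\<lambda>_. c) \<in> R" for c by (auto simp: R_def constant_harmonic_span)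
    fix z w :: "complex^3" assume "z \<noteq> w"
    then obtain j where "z $ j \<noteq> w $ j" by (auto simp: vec_eq_iff)
    then have ne: "Re (z $ j) \<noteq> Re (w $ j) \<or> Im (z $ j) \<noteq> Im (w $ j)" by (simp add: complex_eq_iff)
    have "(\<lambda>x. Re (torus_embedding x $ j)) = (\<lambda>x. cos (freq_dot (axis j 1) x))"
      "(\<lambda>x. Im (torus_embedding x $ j)) = (\<lambda>x. sin (freq_dot (axis j 1) x))"
      by (auto simp: torus_embedding_def exp_Euler cos_of_real sin_of_real)
    moreover have "(\<lambda>x. cos (freq_dot (axis j 1) x)) \<in> ?V" "(\<lambda>x. sin (freq_dot (axis j 1) x)) \<in> ?V"
      by (intro fun_module.span_base in_harmonics UNIV_I)+
    ultimately have "(\<lambda>x. Re (torus_embedding x $ j)) \<in> ?V" "(\<lambda>x. Im (torus_embedding x $ j)) \<in> ?V"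
      by (simp_all only:)
    moreover have "continuous_on ?S (\<lambda>z. Re (z $ j))" "continuous_on ?S (\<lambda>z. Im (z $ j))"
      by (intro continuous_intros)+
    ultimately have "(\<lambda>z. Re (z $ j)) \<in> R" "(\<lambda>z. Im (z $ j)) \<in> R"
      by (simp_all only: R_def mem_Collect_eq simp_thms)
    note R = bexI[OF _ this(1)] bexI[OF _ this(2)]
    from ne show "\<exists>f\<in>R. f z \<noteq> f w"
      by (elim disjE) (fact R)+
  qed
  from function_ring_on.Stone_Weierstrass_basic[OF this F e] obtain G where
    "G \<in> R" "\<forall>z\<in>?S. \<bar>F z - G z\<bar> < e" by blast
  then show ?thesis by (intro bexI[of _ "\<lambda>x. G (torus_embedding x)"]) (auto simp: R_def)
qed

lemma constant_square_integrable: "(\<lambda>_. c) \<in> square_integrable"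
  by (rule continuous_square_integrable) simp

lemma trig_approximable_continuous:
  assumes F: "continuous_on (torus_embedding ` fundamental_cube) F"
  shows "trig_approximable (\<lambda>x. F (torus_embedding x))"
proof -
  let ?S = "torus_embedding ` fundamental_cube"
  have pos: "1 / real (Suc n) > 0" for n by simp
  note uniform_trig_approximation[OF F pos]
  then obtain P where P: "\<And>n. P n \<in> fun_module.span (harmonics UNIV)"
    "\<And>n x. x \<in> fundamental_cube \<Longrightarrow> \<bar>F (torus_embedding x) - P n x\<bar> < 1 / real (Suc n)" by metis
  have "compact (F ` ?S)" unfolding fundamental_cube_def
    by (intro compact_continuous_image compact_torus_image compact_cbox F[unfolded fundamental_cube_def])
  then obtain B where B: "\<And>z. z \<in> ?S \<Longrightarrow> \<bar>F z\<bar> \<le> B"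
    using compact_imp_bounded bounded_iff by (metis imageI real_norm_def)
  show ?thesis
  proof (rule trig_approximable_dominated[where s = P and w = "\<lambda>_. B + 1"])
    show "trig_approximable (P i)" for i by (rule trig_approximable_span[OF P(1)])
    have "continuous_on fundamental_cube (\<lambda>x. F (torus_embedding x))"
      by (rule continuous_on_compose2[OF F continuous_torus_embedding]) auto
    then have "(\<lambda>x. F (torus_embedding x)) \<in> borel_measurable (restrict_space borel fundamental_cube)"
      by (rule borel_measurable_continuous_on_restrict)
    moreover have "sets torus_measure = sets (restrict_space borel fundamental_cube)"
      unfolding torus_measure_def by (intro sets_restrict_space_cong) simp
    ultimately show "(\<lambda>x. F (torus_embedding x)) \<in> borel_measurable torus_measure"
      by (simp cong: measurable_cong_sets)
    have "(\<lambda>i. P i x) \<longlonglongrightarrow> F (torus_embedding x)" if x: "x \<in> fundamental_cube" for x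
    proof (rule LIMSEQ_I)
      fix r :: real assume "r > 0"
      then obtain N where N: "1 / real (Suc N) < r" using nat_approx_posE by blast
      have "norm (P n x - F (torus_embedding x)) < r" if "n \<ge> N" for n
      proof -
        have "1 / real (Suc n) \<le> 1 / real (Suc N)" using that by (simp add: frac_le)
        then show ?thesis using P(2)[OF x, of n] N by (simp add: abs_minus_commute)
      qed
      then show "\<exists>N. \<forall>n\<ge>N. norm (P n x - F (torus_embedding x)) < r" by blast
    qed
    then show "AE x in torus_measure. (\<lambda>i. P i x) \<longlonglongrightarrow> F (torus_embedding x)"
      by (intro AE_I2) simp
    fix i x assume x: "x \<in> fundamental_cube"
    have "1 / real (Suc i) \<le> 1" by simp
    then show "\<bar>P i x\<bar> \<le> B + 1" using P(2)[OF x, of i] B[OF imageI[OF x]] by linarith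
  qed (rule constant_square_integrable)
qed

lemma indicator_measurable_torus:
  "A \<in> sets borel \<Longrightarrow> (indicator A :: _ \<Rightarrow> real) \<in> borel_measurable torus_measure"
  unfolding torus_measure_def by (intro measurable_restrict_space1) simp

text \<open>The indicator of \<open>X\<close> is the pullback of the indicator of the image of \<open>X\<close>, as \<open>X\<close> avoids the
  faces. The latter is the pointwise limit of the continuous functions \<open>max 0 (1 - n dist)\<close>, where
  \<open>dist\<close> is the distance to the image of \<open>X\<close>.\<close>

lemma trig_approximable_compact:
  assumes X: "compact X" "X \<subseteq> box 0 (\<chi> j. 2 * pi)"
  shows "trig_approximable (indicator X)"
proof (cases "X = {}")
  case True
  then have "indicator X = (\<lambda>_. 0 :: real)" by auto
  then show ?thesis using trig_approximable_span[OF constant_harmonic_span[of 0]] by (simp only:)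
next
  case False
  let ?Y = "torus_embedding ` X"
  have Y: "closed ?Y" "?Y \<noteq> {}" using compact_torus_image[OF X(1)] compact_imp_closed False by auto
  show ?thesis
  proof (rule trig_approximable_dominated[where w = "\<lambda>_. 1"
        and s = "\<lambda>n x. max 0 (1 - real n * infdist (torus_embedding x) ?Y)"])
    show "trig_approximable (\<lambda>x. max 0 (1 - real n * infdist (torus_embedding x) ?Y))" for n
      by (rule trig_approximable_continuous[where F = "\<lambda>z. max 0 (1 - real n * infdist z ?Y)"])
        (intro continuous_intros)
    show "(indicator X :: _ \<Rightarrow> real) \<in> borel_measurable torus_measure"
      using X(1) by (simp add: indicator_measurable_torus borel_closed compact_imp_closed)
    have "(\<lambda>n. max 0 (1 - real n * infdist (torus_embedding x) ?Y)) \<longlonglongrightarrow> indicator X x"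
      if x: "x \<in> fundamental_cube" for x
    proof (cases "x \<in> X")
      case True
      then have "infdist (torus_embedding x) ?Y = 0" by auto
      then show ?thesis using True by simp
    next
      case False
      have "torus_embedding x \<notin> ?Y"
        using torus_embedding_inj[OF _ x] X(2) False by force
      then have d: "infdist (torus_embedding x) ?Y > 0"
        using in_closed_iff_infdist_zero[OF Y] infdist_nonneg by (metis less_eq_real_def)
      obtain N :: nat where N: "1 < real N * infdist (torus_embedding x) ?Y"
        using reals_Archimedean3[OF d] by blast
      have "max 0 (1 - real n * infdist (torus_embedding x) ?Y) = 0" if "n \<ge> N" for n
      proof -
        have "real N * infdist (torus_embedding x) ?Y \<le> real n * infdist (torus_embedding x) ?Y"
          using that d by (intro mult_right_mono) auto
        then show ?thesis using N by simp
      qed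
      then have "\<forall>\<^sub>F n in sequentially. max 0 (1 - real n * infdist (torus_embedding x) ?Y) = 0"
        by (auto simp: eventually_sequentially)
      then show ?thesis using False by (simp add: tendsto_eventually)
    qed
    then show "AE x in torus_measure. (\<lambda>n. max 0 (1 - real n * infdist (torus_embedding x) ?Y)) \<longlonglongrightarrow> indicator X x"
      by (intro AE_I2) simp
    show "\<bar>max 0 (1 - real n * infdist (torus_embedding x) ?Y)\<bar> \<le> 1" for n x
      by (simp add: infdist_nonneg)
  qed (rule constant_square_integrable)
qed

lemma AE_torus_interior: "AE x in torus_measure. x \<in> box 0 (\<chi> j. 2 * pi)"
proof -
  let ?b = "(\<chi> j. 2 * pi) :: real^3"
  have "emeasure lborel (cbox 0 ?b - box 0 ?b) = emeasure lborel (cbox 0 ?b) - emeasure lborel (box 0 ?b)"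
    by (intro emeasure_Diff box_subset_cbox) (use emeasure_lborel_box_finite[of 0 ?b] in auto)
  also have "\<dots> = 0" by (simp add: emeasure_lborel_cbox_eq emeasure_lborel_box_eq)
  finally have 0: "emeasure lborel (cbox 0 ?b - box 0 ?b) = 0" .
  have "AE x in lborel. x \<in> fundamental_cube \<longrightarrow> x \<in> box 0 ?b"
    by (rule AE_I[OF _ 0]) (auto simp: fundamental_cube_def)
  then show ?thesis unfolding torus_measure_def by (subst AE_restrict_space_iff) auto
qed

text \<open>The faces are a null set, and \<open>X\<close> is exhausted in the open cube by compact sets.\<close>

lemma trig_approximable_closed:
  assumes X: "closed X"
  shows "trig_approximable (indicator X)"
proof -
  let ?C = "\<lambda>n. cbox (\<chi> j. 1 / real (Suc n)) (\<chi> j. 2 * pi - 1 / real (Suc n)) :: (real^3) set"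
  show ?thesis
  proof (rule trig_approximable_dominated[where w = "\<lambda>_. 1" and s = "\<lambda>n. indicator (X \<inter> ?C n)"])
    have pos: "0 < 1 / real (Suc n)" for n by simp
    have "x \<in> box 0 (\<chi> j. 2 * pi)" if "x \<in> ?C n" for n and x :: "real^3"
      unfolding mem_box_cart
    proof (intro allI)
      fix i
      have "1 / real (Suc n) \<le> x $ i" "x $ i \<le> 2 * pi - 1 / real (Suc n)"
        using that by (auto simp: mem_box_cart)
      then show "0 $ i < x $ i \<and> x $ i < (\<chi> j. 2 * pi) $ i" using pos[of n]
        by (simp only: zero_index vec_lambda_beta) linarith
    qed
    then show "trig_approximable (indicator (X \<inter> ?C n))" for n
      by (intro trig_approximable_compact closed_Int_compact X compact_cbox) blast
    show "(indicator X :: _ \<Rightarrow> real) \<in> borel_measurable torus_measure"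
      using X by (simp add: indicator_measurable_torus borel_closed)
    show "AE x in torus_measure. (\<lambda>n. indicator (X \<inter> ?C n) x :: real) \<longlonglongrightarrow> indicator X x"
      using AE_torus_interior
    proof eventually_elim
      case (elim x)
      have "\<forall>\<^sub>F n in sequentially. x \<in> ?C n"
      proof -
        have "\<forall>\<^sub>F n in sequentially. 1 / real (Suc n) < x $ i \<and> 1 / real (Suc n) < 2 * pi - x $ i" for i
        proof -
          have lim: "(\<lambda>n. 1 / real (Suc n)) \<longlonglongrightarrow> 0"
            using LIMSEQ_inverse_real_of_nat by (simp add: inverse_eq_divide)
          have "0 < x $ i" "0 < 2 * pi - x $ i" using elim by (auto simp: mem_box_cart)
          then show ?thesis by (intro eventually_conj order_tendstoD(2)[OF lim])
        qed
        then have "\<forall>\<^sub>F n in sequentially. \<forall>i. 1 / real (Suc n) < x $ i \<and> 1 / real (Suc n) < 2 * pi - x $ i"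
          by (intro eventually_all_finite)
        then show ?thesis by eventually_elim (auto simp: mem_box_cart less_imp_le less_diff_eq algebra_simps)
      qed
      then have "\<forall>\<^sub>F n in sequentially. (indicator (X \<inter> ?C n) x :: real) = indicator X x"
        by eventually_elim (simp add: indicator_def)
      then show ?case by (rule tendsto_eventually)
    qed
    show "\<bar>indicator (X \<inter> ?C n) x :: real\<bar> \<le> 1" for n x by (simp add: indicator_def)
  qed (rule constant_square_integrable)
qed

text \<open>Dynkin's theorem, for the intersection-stable family of closed sets.\<close>

lemma trig_approximable_borel:
  assumes "A \<in> sets borel"
  shows "trig_approximable (indicator A)"
proof -
  have A: "A \<in> sigma_sets UNIV (Collect closed)"
    using assms unfolding borel_eq_closed by simp
  have "Int_stable (Collect closed :: (real^3) set set)" by (auto simp: Int_stable_def)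
  from this subset_UNIV[of "Collect closed", folded Pow_UNIV] A show ?thesis
  proof (induction rule: sigma_sets_induct_disjoint)
    case (basic A)
    then show ?case by (simp add: trig_approximable_closed)
  next
    case empty
    then show ?case by (rule trig_approximable_closed) simp
  next
    case (compl A)
    have "(indicator (UNIV - A) :: real^3 \<Rightarrow> real) = (\<lambda>_. 1) + fscale (-1) (indicator A)"
      by (auto simp: fscale_def indicator_def)
    then show ?case
      using trig_approximable_add[OF trig_approximable_span[OF constant_harmonic_span[of 1]] trig_approximable_scale[OF compl(2), of "-1"]]
      by (simp only:)
  next
    case (union A)
    have Ab: "A i \<in> sets borel" for i
      using union(2) unfolding borel_eq_closed by (auto simp: subset_eq)
    have fin: "trig_approximable (indicator (\<Union>i<n. A i))" for n :: nat
    proof (induction n)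
      case 0
      show ?case using trig_approximable_closed[of "{}"] by (simp only: lessThan_0 UN_empty closed_empty)
    next
      case (Suc n)
      have "(indicator (\<Union>i<Suc n. A i) :: real^3 \<Rightarrow> real) = indicator (\<Union>i<n. A i) + indicator (A n)"
      proof (rule ext)
        fix x
        have "x \<in> A n \<Longrightarrow> i < n \<Longrightarrow> x \<notin> A i" for i
          using disjoint_family_onD[OF union(1), of i n] by auto
        then show "(indicator (\<Union>i<Suc n. A i) x :: real) = (indicator (\<Union>i<n. A i) + indicator (A n)) x"
          by (auto simp: indicator_def less_Suc_eq)
      qed
      then show ?case using trig_approximable_add[OF Suc union(3)[of n]] by (simp only:)
    qed
    show ?case
    proof (rule trig_approximable_dominated[OF fin _ _ constant_square_integrable[of 1]])
      show "(indicator (\<Union> (range A)) :: _ \<Rightarrow> real) \<in> borel_measurable torus_measure"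
        using Ab by (intro indicator_measurable_torus) auto
      show "AE x in torus_measure. (\<lambda>n. indicator (\<Union>i<n. A i) x :: real) \<longlonglongrightarrow> indicator (\<Union> (range A)) x"
        by (intro AE_I2 LIMSEQ_indicator_UN)
    qed (simp add: indicator_def)
  qed
qed

lemma trig_approximable_cong_AE:
  assumes g: "trig_approximable g" and f: "f \<in> borel_measurable torus_measure"
    and eq: "AE x in torus_measure. g x = f x"
  shows "trig_approximable f"
proof -
  have sq: "(\<lambda>x. \<bar>g x\<bar>) \<in> square_integrable"
    using g by (auto simp: trig_approximable_def square_integrable_def)
  have "AE x in torus_measure. (\<lambda>i::nat. g x) \<longlonglongrightarrow> f x"
    using eq by eventually_elim simp
  then show ?thesis
    by (rule trig_approximable_dominated[where s = "\<lambda>_. g", OF g f _ sq]) simp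
qed

lemma trig_approximable_simple_nonneg:
  assumes "simple_function torus_measure f" "\<And>x. f x \<ge> 0"
  shows "trig_approximable f"
  using assms(1)
proof (induction rule: simple_function_induct_real)
  case (cong f g)
  show ?case
    by (rule trig_approximable_cong_AE[OF cong(4) borel_measurable_simple_function[OF cong(2)] cong(3)])
next
  case (set A)
  have "A \<in> sets borel"
    using set unfolding torus_measure_def by (subst (asm) sets_restrict_space_iff) auto
  then show ?case by (rule trig_approximable_borel)
next
  case (mult u c)
  then show ?case using trig_approximable_scale[of u c] by (simp add: fscale_def)
next
  case (add u v)
  then show ?case using trig_approximable_add[of u v] by (simp add: plus_fun_def)
qed (rule assms(2))

lemma trig_approximable_simple:
  assumes f: "simple_function torus_measure f"
  shows "trig_approximable f"
proof -
  have "simple_function torus_measure (\<lambda>x. max 0 (f x))" "simple_function torus_measure (\<lambda>x. max 0 (- f x))"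
    using simple_function_compose[OF f, of "max 0"] simple_function_compose[OF f, of "\<lambda>t. max 0 (- t)"]
    by (simp_all add: o_def)
  then have "trig_approximable (\<lambda>x. max 0 (f x))" "trig_approximable (\<lambda>x. max 0 (- f x))"
    by (auto intro: trig_approximable_simple_nonneg)
  then have "trig_approximable ((\<lambda>x. max 0 (f x)) + fscale (-1) (\<lambda>x. max 0 (- f x)))"
    by (intro trig_approximable_add trig_approximable_scale)
  also have "(\<lambda>x. max 0 (f x)) + fscale (-1) (\<lambda>x. max 0 (- f x)) = f"
    by (auto simp: fscale_def max_def)
  finally show ?thesis .
qed

lemma square_integrable_trig_approximable:
  assumes f: "f \<in> square_integrable"
  shows "trig_approximable f"
proof -
  have fm: "f \<in> borel_measurable torus_measure" using f by (simp add: square_integrable_def)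
  from borel_measurable_implies_sequence_metric[OF this, of 0] obtain s where
    s: "\<And>i. simple_function torus_measure (s i)"
       "\<And>x. x \<in> fundamental_cube \<Longrightarrow> (\<lambda>i. s i x) \<longlonglongrightarrow> f x"
       "\<And>i x. x \<in> fundamental_cube \<Longrightarrow> dist (s i x) 0 \<le> 2 * dist (f x) 0"
    unfolding space_torus_measure by blast
  have w: "(\<lambda>x. 2 * \<bar>f x\<bar>) \<in> square_integrable"
    using f by (auto simp: square_integrable_def power_mult_distrib)
  show ?thesis
    by (rule trig_approximable_dominated[where s = s, OF trig_approximable_simple[OF s(1)] fm _ w])
      (use s(2,3) in auto)
qed

section \<open>Weak derivatives and density in the Sobolev space\<close>

lemma is_weak_partial_iff:
  "is_weak_partial j f g \<longleftrightarrow> g \<in> torus_L2 \<and>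
     (\<forall>\<phi>. torus_smooth \<phi> \<longrightarrow> L2_inner f (partial_deriv j \<phi>) = - L2_inner g \<phi>)"
  unfolding is_weak_partial_def set_integral_torus L2_inner_def ..

lemma torus_smooth_by_parts:
  assumes f: "torus_smooth f" and g: "torus_smooth g"
  shows "L2_inner f (partial_deriv j g) = - L2_inner (partial_deriv j f) g"
proof -
  note F = torus_smooth_facts[OF f] and G = torus_smooth_facts[OF g]
  let ?h = "\<lambda>x. f x * g x"
  have pd: "partial_deriv j ?h = (\<lambda>x. f x * partial_deriv j g x + partial_deriv j f x * g x)"
    by (rule ext) (rule partial_deriv_mult[OF F(2) G(2)])
  have c1: "continuous_on UNIV (\<lambda>x. f x * partial_deriv j g x)"
    and c2: "continuous_on UNIV (\<lambda>x. partial_deriv j f x * g x)"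
    by (intro continuous_on_mult F G)+
  have "integral fundamental_cube (partial_deriv j ?h) = 0"
    by (rule integral_partial_deriv_periodic)
      (use F G c1 c2 in \<open>auto simp: pd intro!: torus_periodic_mult continuous_on_add\<close>)
  moreover have "(LINT x|torus_measure. partial_deriv j ?h x) = integral fundamental_cube (partial_deriv j ?h)"
    by (rule continuous_torus_integral) (unfold pd, intro continuous_on_add c1 c2)
  moreover have "(LINT x|torus_measure. partial_deriv j ?h x) = L2_inner f (partial_deriv j g) + L2_inner (partial_deriv j f) g"
    unfolding pd L2_inner_def
    by (intro Bochner_Integration.integral_add continuous_torus_integral c1 c2)
  ultimately show ?thesis by simp
qed

lemma harmonic_span_torus_L2: "f \<in> fun_module.span (harmonics F) \<Longrightarrow> f \<in> torus_L2"
  using harmonic_span_diff harmonic_span_continuous continuous_torus_L2 by blast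

text \<open>Integration by parts identifies the weak with the classical derivative.\<close>

lemma harmonic_span_weak_partial:
  assumes "f \<in> fun_module.span (harmonics F)"
  shows "is_weak_partial j f (partial_deriv j f)"
  unfolding is_weak_partial_iff
  using harmonic_span_torus_L2 harmonic_span_diff[OF assms] torus_smooth_by_parts[OF harmonic_span_smooth[OF assms]]
  by blast

lemma harmonic_span_H1: "f \<in> fun_module.span (harmonics F) \<Longrightarrow> f \<in> torus_H1"
  unfolding torus_H1_def using harmonic_span_torus_L2 harmonic_span_weak_partial by blast

lemma torus_L2_diff:
  assumes "f \<in> torus_L2" "g \<in> torus_L2"
  shows "f - g \<in> torus_L2"
proof -
  have "f - g \<in> square_integrable"
    using assms by (intro square_integrable_diff torus_L2_square_integrable)
  moreover have "torus_periodic (f - g)" "f - g \<in> borel_measurable borel"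
    using assms by (auto simp: torus_L2_def torus_periodic_def fun_diff_def)
  ultimately show ?thesis
    unfolding torus_L2_def set_integrable_torus square_integrable_def by simp
qed

lemma weak_partial_diff:
  assumes u: "u \<in> torus_L2" "is_weak_partial j u g" and f: "f \<in> fun_module.span (harmonics F)"
  shows "is_weak_partial j (u - f) (g - partial_deriv j f)"
proof -
  have fw: "is_weak_partial j f (partial_deriv j f)" using harmonic_span_weak_partial[OF f] .
  have g: "g \<in> torus_L2" "partial_deriv j f \<in> torus_L2"
    using u(2) fw by (auto simp: is_weak_partial_def)
  show ?thesis unfolding is_weak_partial_iff
  proof (intro conjI allI impI)
    show "g - partial_deriv j f \<in> torus_L2" using g by (rule torus_L2_diff)
    fix \<phi> assume \<phi>: "torus_smooth \<phi>"
    have s: "\<phi> \<in> square_integrable" "partial_deriv j \<phi> \<in> square_integrable"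
      using torus_smooth_facts[OF \<phi>] continuous_square_integrable by blast+
    have "L2_inner u (partial_deriv j \<phi>) = - L2_inner g \<phi>"
      "L2_inner f (partial_deriv j \<phi>) = - L2_inner (partial_deriv j f) \<phi>"
      using u(2) fw \<phi> unfolding is_weak_partial_iff by blast+
    moreover have "u \<in> square_integrable" "g \<in> square_integrable" "f \<in> square_integrable" "partial_deriv j f \<in> square_integrable"
      using u(1) g harmonic_span_square_integrable[OF f] by (simp_all add: torus_L2_square_integrable)
    ultimately show "L2_inner (u - f) (partial_deriv j \<phi>) = - L2_inner (g - partial_deriv j f) \<phi>"
      using s by (simp add: L2_inner_diff_left)
  qed
qed

lemma L2_orthogonal_harmonics_null:
  assumes d: "d \<in> square_integrable"
    and orth: "\<And>P. P \<in> fun_module.span (harmonics UNIV) \<Longrightarrow> L2_inner d P = 0"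
  shows "AE x in torus_measure. d x = 0"
proof (rule L2_inner_null[OF d])
  have "L2_inner d d \<le> e" if e: "e > 0" for e
  proof -
    obtain P where P: "P \<in> fun_module.span (harmonics UNIV)" "L2_inner (d - P) (d - P) < e"
      using square_integrable_trig_approximable[OF d] e unfolding trig_approximable_def by blast
    have Ps: "P \<in> square_integrable" using harmonic_span_square_integrable[OF P(1)] .
    have "L2_inner (d - P) (d - P) = L2_inner d d + L2_inner P P"
      using d Ps orth[OF P(1)]
      by (simp add: L2_inner_diff_left L2_inner_diff_right square_integrable_diff L2_inner_commute[of P d])
    then show ?thesis using P(2) L2_inner_nonneg[of P] by linarith
  qed
  then have "L2_inner d d \<le> 0" by (metis field_le_epsilon add_0)
  then show "L2_inner d d = 0" using L2_inner_nonneg[of d] by linarith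
qed

text \<open>The difference of two weak derivatives is orthogonal to all trigonometric polynomials, hence null.
  The norm of \<open>H\<^sup>1\<close> can thus be computed with any weak derivative in place of the chosen one.\<close>

lemma weak_partial_norm_unique:
  assumes g: "is_weak_partial j f g" and h: "is_weak_partial j f h"
  shows "L2_inner g g = L2_inner h h"
proof -
  have s: "g \<in> square_integrable" "h \<in> square_integrable"
    using g h torus_L2_square_integrable by (auto simp: is_weak_partial_def)
  have "L2_inner (g - h) P = 0" if P: "P \<in> fun_module.span (harmonics UNIV)" for P
  proof -
    have "- L2_inner g P = - L2_inner h P"
      using g h harmonic_span_smooth[OF P] unfolding is_weak_partial_iff by metis
    then show ?thesis using s harmonic_span_square_integrable[OF P] by (simp add: L2_inner_diff_left)
  qed
  then have "AE x in torus_measure. (g - h) x = 0"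
    by (intro L2_orthogonal_harmonics_null square_integrable_diff s)
  then have "AE x in torus_measure. g x * g x = h x * h x" by eventually_elim simp
  then show ?thesis unfolding L2_inner_def
    using s by (intro integral_cong_AE) (auto simp: square_integrable_def)
qed

lemma H1_norm_diff:
  assumes u: "u \<in> torus_H1" and g: "\<And>j. is_weak_partial j u (g j)" and f: "f \<in> fun_module.span (harmonics F)"
  shows "H1_norm (\<lambda>x. u x - f x) =
    sqrt (L2_inner (u - f) (u - f) + (\<Sum>j\<in>UNIV. L2_inner (g j - partial_deriv j f) (g j - partial_deriv j f)))"
proof -
  have uL: "u \<in> torus_L2" using u by (simp add: torus_H1_def)
  have w: "is_weak_partial j (u - f) (g j - partial_deriv j f)" for j
    using weak_partial_diff[OF uL g f] .
  have "is_weak_partial j (u - f) (weak_partial j (u - f))" for j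
    unfolding weak_partial_def by (rule someI[of _ "g j - partial_deriv j f"]) (rule w)
  then have "L2_inner (weak_partial j (u - f)) (weak_partial j (u - f)) =
      L2_inner (g j - partial_deriv j f) (g j - partial_deriv j f)" for j
    using w weak_partial_norm_unique by blast
  then have "H1_norm (u - f) =
    sqrt (L2_inner (u - f) (u - f) + (\<Sum>j\<in>UNIV. L2_inner (g j - partial_deriv j f) (g j - partial_deriv j f)))"
    unfolding H1_norm_def set_integral_torus L2_inner_self[symmetric] by (simp only:)
  then show ?thesis by (simp add: fun_diff_def)
qed

lemma harmonic_span_finite:
  assumes "f \<in> fun_module.span (harmonics B)"
  obtains F where "finite F" "F \<subseteq> B" "f \<in> fun_module.span (harmonics F)"
proof -
  have "\<exists>F. finite F \<and> F \<subseteq> B \<and> f \<in> fun_module.span (harmonics F)"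
    using assms
  proof (induction rule: fun_module.span_induct_alt)
    case base
    then show ?case using fun_module.span_zero by blast
  next
    case (step c x y)
    then obtain F where F: "finite F" "F \<subseteq> B" "y \<in> fun_module.span (harmonics F)" by blast
    from step(1) obtain k where k: "k \<in> B" "x \<in> harmonics {k}" by (auto simp: harmonics_def)
    have "fun_module.span (harmonics {k}) \<subseteq> fun_module.span (harmonics (insert k F))"
      "fun_module.span (harmonics F) \<subseteq> fun_module.span (harmonics (insert k F))"
      by (intro fun_module.span_mono harmonics_mono, blast)+
    then have "x \<in> fun_module.span (harmonics (insert k F))" "y \<in> fun_module.span (harmonics (insert k F))"
      using k(2) F(3) fun_module.span_base by blast+
    then have "fscale c x + y \<in> fun_module.span (harmonics (insert k F))"
      by (intro fun_module.span_add fun_module.span_scale)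
    moreover have "finite (insert k F)" "insert k F \<subseteq> B" using F(1,2) k(1) by auto
    ultimately show ?case by (intro exI conjI)
  qed
  then show ?thesis using that by blast
qed

text \<open>Approximants \<open>Q0\<close> of \<open>u\<close> and \<open>Q j\<close> of the weak derivatives \<open>g j\<close> are in general unrelated. They
  are replaced by \<open>P\<close> and its derivatives, where \<open>P\<close> is the projection of \<open>u\<close> onto the harmonics of
  their joint frequency set: the derivatives of \<open>P\<close> are the projections of the \<open>g j\<close>, so none of the
  four errors increases.\<close>

lemma harmonic_span_dense_H1:
  assumes u: "u \<in> torus_H1" and e: "e > 0"
  shows "\<exists>f\<in>fun_module.span (harmonics UNIV). H1_norm (\<lambda>x. u x - f x) < e"
proof -
  have uL: "u \<in> torus_L2" and "\<forall>j. \<exists>g. is_weak_partial j u g"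
    using u by (auto simp: torus_H1_def)
  then obtain g where g: "\<And>j. is_weak_partial j u (g j)" by metis
  have us: "u \<in> square_integrable" using uL by (rule torus_L2_square_integrable)
  have gs: "g j \<in> square_integrable" for j
    using g[of j] torus_L2_square_integrable by (auto simp: is_weak_partial_def)
  \<comment> \<open>Four squared errors, for \<open>u\<close> and three derivatives, have to sum up to less than \<open>e\<^sup>2\<close>.\<close>
  let ?d = "e\<^sup>2 / 4"
  have d: "?d > 0" using e by simp
  have ap: "\<exists>Q F. finite F \<and> Q \<in> fun_module.span (harmonics F) \<and> L2_inner (h - Q) (h - Q) < ?d"
    if h: "h \<in> square_integrable" for h
  proof -
    obtain Q where Q: "Q \<in> fun_module.span (harmonics UNIV)" "L2_inner (h - Q) (h - Q) < ?d"
      using square_integrable_trig_approximable[OF h] d unfolding trig_approximable_def by blast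
    obtain F where "finite F" "Q \<in> fun_module.span (harmonics F)" using harmonic_span_finite[OF Q(1)] .
    then show ?thesis using Q(2) by blast
  qed
  obtain Q0 F0 where Q0: "finite F0" "Q0 \<in> fun_module.span (harmonics F0)" "L2_inner (u - Q0) (u - Q0) < ?d"
    using ap[OF us] by blast
  have "\<forall>j. \<exists>Q F. finite F \<and> Q \<in> fun_module.span (harmonics F) \<and> L2_inner (g j - Q) (g j - Q) < ?d"
    using ap[OF gs] by blast
  then obtain Q G where Q: "\<And>j. finite (G j)" "\<And>j. Q j \<in> fun_module.span (harmonics (G j))"
    "\<And>j. L2_inner (g j - Q j) (g j - Q j) < ?d" by metis
  define F where "F = F0 \<union> (\<Union>j. G j)"
  have fin: "finite (harmonics F)" using Q0(1) Q(1) by (auto simp: F_def harmonics_def)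
  have mono: "fun_module.span (harmonics A) \<subseteq> fun_module.span (harmonics F)" if "A \<subseteq> F" for A
    using that by (intro fun_module.span_mono harmonics_mono)
  have Q0F: "Q0 \<in> fun_module.span (harmonics F)" using mono[of F0] Q0(2) F_def by blast
  have QF: "Q j \<in> fun_module.span (harmonics F)" for j using mono[of "G j"] Q(2) F_def by blast
  obtain P where P: "P \<in> fun_module.span (harmonics F)" "\<And>b. b \<in> harmonics F \<Longrightarrow> L2_inner (u - P) b = 0"
    using L2_projection_exists[OF fin harmonics_square_integrable us] by blast
  have Ps: "P \<in> square_integrable" using harmonic_span_square_integrable[OF P(1)] .
  have dP: "partial_deriv j P \<in> fun_module.span (harmonics F)" for j
    using harmonic_span_diff[OF P(1)] by blast
  \<comment> \<open>Moving the derivative onto the harmonic \<open>b\<close> stays in the span to which \<open>u - P\<close> is orthogonal.\<close>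
  have orth: "L2_inner (g j - partial_deriv j P) b = 0" if b: "b \<in> harmonics F" for j b
  proof -
    have bs: "b \<in> fun_module.span (harmonics F)" using b by (rule fun_module.span_base)
    have db: "partial_deriv j b \<in> fun_module.span (harmonics F)"
      using harmonic_span_diff[OF bs] by blast
    have "is_weak_partial j (u - P) (g j - partial_deriv j P)"
      using weak_partial_diff[OF uL g P(1)] .
    then have "L2_inner (u - P) (partial_deriv j b) = - L2_inner (g j - partial_deriv j P) b"
      using harmonic_span_smooth[OF bs] unfolding is_weak_partial_iff by blast
    moreover have "L2_inner (u - P) (partial_deriv j b) = 0"
      by (rule L2_orthogonal_span[OF square_integrable_diff[OF us Ps] harmonics_square_integrable P(2) db])
    ultimately show ?thesis by simp
  qed
  have 1: "L2_inner (u - P) (u - P) < ?d"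
    using L2_projection_best[OF harmonics_square_integrable us P Q0F] Q0(3) by linarith
  have 2: "L2_inner (g j - partial_deriv j P) (g j - partial_deriv j P) < ?d" for j
    using L2_projection_best[OF harmonics_square_integrable gs dP orth QF] Q(3)[of j] by (meson le_less_trans)
  have "(\<Sum>j\<in>(UNIV::3 set). L2_inner (g j - partial_deriv j P) (g j - partial_deriv j P)) < (\<Sum>j\<in>(UNIV::3 set). ?d)"
    by (rule sum_strict_mono) (use 2 in auto)
  then have "L2_inner (u - P) (u - P) + (\<Sum>j\<in>UNIV. L2_inner (g j - partial_deriv j P) (g j - partial_deriv j P)) < e\<^sup>2"
    using 1 by simp
  then have "H1_norm (\<lambda>x. u x - P x) < e"
    unfolding H1_norm_diff[OF u g P(1)] using e by (intro real_less_lsqrt) auto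
  moreover have "P \<in> fun_module.span (harmonics UNIV)"
    using P(1) fun_module.span_mono[OF harmonics_mono[OF subset_UNIV]] by blast
  ultimately show ?thesis by blast
qed

section \<open>Modes outside the coset are missed\<close>

text \<open>A shift by \<open>\<pi> / \<bar>m\<^sub>j\<bar>\<close> in a direction with \<open>m\<^sub>j \<noteq> 0\<close> changes the sign of both functions but not their
  integrals.\<close>

lemma harmonic_integral_zero:
  assumes m: "m \<noteq> 0"
  shows "(LINT x|torus_measure. cos (freq_dot m x)) = 0" "(LINT x|torus_measure. sin (freq_dot m x)) = 0"
proof -
  obtain j where j: "m $ j \<noteq> 0" using m by (auto simp: vec_eq_iff)
  define t where "t = pi / \<bar>real_of_int (m $ j)\<bar>"
  have "1 \<le> \<bar>real_of_int (m $ j)\<bar>" using j by linarith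
  then have t: "0 \<le> t" "t \<le> 2 * pi"
    unfolding t_def using pi_gt_zero by (auto simp: field_simps intro: order_trans[of pi "2 * pi"] mult_mono)
  have mt: "of_int (m $ j) * t = pi \<or> of_int (m $ j) * t = - pi"
    unfolding t_def using j by (cases "m $ j > 0") (auto simp: field_simps)
  have sh: "cos (freq_dot m (x + axis j t)) = - cos (freq_dot m x)"
     "sin (freq_dot m (x + axis j t)) = - sin (freq_dot m x)" for x
    using mt by (auto simp: cos_add sin_add)
  have c: "continuous_on UNIV (\<lambda>x. cos (freq_dot m x))" "continuous_on UNIV (\<lambda>x. sin (freq_dot m x))"
    by (intro harmonic_span_continuous[of _ UNIV] fun_module.span_base in_harmonics UNIV_I)+
  have "integral fundamental_cube (\<lambda>x. cos (freq_dot m x)) = 0" "integral fundamental_cube (\<lambda>x. sin (freq_dot m x)) = 0"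
    using integral_periodic_shift[OF c(1) harmonic_periodic(1) t, of j]
      integral_periodic_shift[OF c(2) harmonic_periodic(2) t, of j] by (simp_all only: sh integral_neg)
  then show "(LINT x|torus_measure. cos (freq_dot m x)) = 0" "(LINT x|torus_measure. sin (freq_dot m x)) = 0"
    using continuous_torus_integral(2)[OF c(1)] continuous_torus_integral(2)[OF c(2)] by simp_all
qed

text \<open>The products are combinations of harmonics of the frequencies \<open>l + k\<close> and \<open>l - k\<close> up to sign, both
  nonzero. The frequency \<open>- l\<close> has to be excluded too, as it gives the same cosine.\<close>

lemma cos_orthogonal_harmonics:
  assumes l: "l \<notin> B" "- l \<notin> B" and b: "b \<in> harmonics B"
  shows "L2_inner (\<lambda>x. cos (freq_dot l x)) b = 0"
proof -
  have ic: "integrable torus_measure (\<lambda>x. cos (freq_dot m x))" "integrable torus_measure (\<lambda>x. sin (freq_dot m x))" for m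
    by (intro continuous_torus_integral harmonic_span_continuous[of _ UNIV] fun_module.span_base in_harmonics UNIV_I)+
  from b consider k where "k \<in> B" "b = (\<lambda>x. cos (freq_dot k x))" | k where "k \<in> B" "b = (\<lambda>x. sin (freq_dot k x))"
    by (auto simp: harmonics_def)
  then show ?thesis
  proof cases
    case (1 k)
    have ne: "l - k \<noteq> 0" "l + k \<noteq> 0" using 1(1) l by (auto simp: add_eq_0_iff)
    have "(\<lambda>x. cos (freq_dot l x) * b x) = (\<lambda>x. cos (freq_dot (l - k) x) / 2 + cos (freq_dot (l + k) x) / 2)"
      unfolding 1 by (rule ext) (simp add: cos_times_cos add_divide_distrib)
    then show ?thesis unfolding L2_inner_def
      using ic harmonic_integral_zero[OF ne(1)] harmonic_integral_zero[OF ne(2)]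
      by (simp only: Bochner_Integration.integral_add integrable_divide integral_divide_zero)
  next
    case (2 k)
    have ne: "k - l \<noteq> 0" "k + l \<noteq> 0" using 2(1) l by (auto simp: add_eq_0_iff2)
    have "(\<lambda>x. cos (freq_dot l x) * b x) = (\<lambda>x. sin (freq_dot (k + l) x) / 2 + sin (freq_dot (k - l) x) / 2)"
      unfolding 2 by (rule ext) (simp add: mult.commute[of "cos _"] sin_times_cos add_divide_distrib)
    then show ?thesis unfolding L2_inner_def
      using ic harmonic_integral_zero[OF ne(1)] harmonic_integral_zero[OF ne(2)]
      by (simp only: Bochner_Integration.integral_add integrable_divide integral_divide_zero)
  qed
qed

text \<open>The integrand is continuous and nonnegative, and does not vanish at the origin.\<close>

lemma L2_inner_cos_pos: "L2_inner (\<lambda>x. cos (freq_dot l x)) (\<lambda>x. cos (freq_dot l x)) > 0"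
proof -
  let ?f = "\<lambda>x. cos (freq_dot l x) * cos (freq_dot l x)"
  have c: "continuous_on UNIV (\<lambda>x. cos (freq_dot l x))"
    by (intro harmonic_span_continuous[of _ UNIV] fun_module.span_base in_harmonics UNIV_I)
  then have cf: "continuous_on UNIV ?f" by (intro continuous_on_mult)
  have "box 0 (\<chi> j. 2 * pi) \<noteq> ({} :: (real^3) set)" by (auto simp: interval_ne_empty_cart)
  then have "integral fundamental_cube ?f = 0 \<longleftrightarrow> (\<forall>x\<in>fundamental_cube. ?f x = 0)"
    unfolding fundamental_cube_def
    by (intro integral_cbox_eq_0_iff continuous_on_subset[OF cf]) auto
  moreover have "0 \<in> fundamental_cube" by (simp add: fundamental_cube_iff)
  moreover have "freq_dot l 0 = 0" by (simp add: freq_dot_def)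
  ultimately have "integral fundamental_cube ?f \<noteq> 0" by fastforce
  then have "L2_inner (\<lambda>x. cos (freq_dot l x)) (\<lambda>x. cos (freq_dot l x)) \<noteq> 0"
    unfolding L2_inner_def using continuous_torus_integral(2)[OF cf] by simp
  then show ?thesis using L2_inner_nonneg[of "\<lambda>x. cos (freq_dot l x)"] by linarith
qed

section \<open>Saturation criteria\<close>

lemma sat_space_subset_harmonic_span:
  assumes "k0 \<in> forcing_freqs \<epsilon> K"
  shows "sat_space (forcing_profiles \<epsilon> K) \<subseteq> fun_module.span (harmonics {k0 + g | g. g \<in> pair_lattice \<epsilon> K})"
proof
  fix f assume "f \<in> sat_space (forcing_profiles \<epsilon> K)"
  then have "(\<lambda>x. complex_of_real (f x)) \<in> sat_space_complex (forcing_profiles \<epsilon> K)"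
    unfolding sat_space_complex_def by (intro fun_module.span_base imageI)
  then show "f \<in> fun_module.span (harmonics {k0 + g | g. g \<in> pair_lattice \<epsilon> K})"
    unfolding sat_space_complex_eq[OF assms] by (rule Re_span_fourier_modes)
qed

lemma harmonic_span_subset_sat_space:
  assumes "k0 \<in> forcing_freqs \<epsilon> K"
  shows "fun_module.span (harmonics {k0 + g | g. g \<in> pair_lattice \<epsilon> K}) \<subseteq> sat_space (forcing_profiles \<epsilon> K)"
proof -
  let ?S = "sat_space (forcing_profiles \<epsilon> K)"
  have S: "fun_module.subspace ?S" by (simp add: sat_space_def)
  have "(\<lambda>x. cos (freq_dot k x)) \<in> ?S \<and> (\<lambda>x. sin (freq_dot k x)) \<in> ?S"
    if "k \<in> {k0 + g | g. g \<in> pair_lattice \<epsilon> K}" for k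
  proof -
    have mode: "fourier_mode k \<in> fun_module.span ((\<lambda>f x. complex_of_real (f x)) ` ?S)"
      unfolding sat_space_complex_eq[OF assms, unfolded sat_space_complex_def]
      by (rule fun_module.span_base[OF imageI[OF that]])
    have "(\<lambda>x. Re (fourier_mode k x)) \<in> ?S \<and> (\<lambda>x. Im (fourier_mode k x)) \<in> ?S"
    proof (rule Re_Im_span[OF S _ mode])
      fix h assume "h \<in> (\<lambda>f x. complex_of_real (f x)) ` ?S"
      then obtain f where "f \<in> ?S" "h = (\<lambda>x. complex_of_real (f x))" by (elim imageE)
      then show "(\<lambda>x. Re (h x)) \<in> ?S \<and> (\<lambda>x. Im (h x)) \<in> ?S"
        using fun_module.subspace_0[OF S] by (simp add: zero_fun_def)
    qed
    then show ?thesis by (simp add: fourier_mode_eq)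
  qed
  then have "harmonics {k0 + g | g. g \<in> pair_lattice \<epsilon> K} \<subseteq> ?S"
    unfolding harmonics_def by blast
  then show ?thesis by (rule fun_module.span_minimal[OF _ S])
qed

lemma saturating_if_full:
  assumes K: "K \<noteq> {}" and full: "pair_lattice \<epsilon> K = UNIV"
  shows "cubically_saturating (forcing_profiles \<epsilon> K)"
proof -
  obtain k0 where k0: "k0 \<in> forcing_freqs \<epsilon> K" using K by (auto simp: forcing_freqs_def)
  have "{k0 + g | g. g \<in> pair_lattice \<epsilon> K} = UNIV"
  proof -
    have "k = k0 + (k - k0)" for k :: "int^3" by simp
    then show ?thesis unfolding full by blast
  qed
  then have "sat_space (forcing_profiles \<epsilon> K) = fun_module.span (harmonics UNIV)"
    using sat_space_subset_harmonic_span[OF k0] harmonic_span_subset_sat_space[OF k0] by auto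
  then show ?thesis
    unfolding cubically_saturating_def dense_in_H1_def
    using harmonic_span_H1 harmonic_span_dense_H1 by auto
qed

text \<open>The coset is closed under negation because \<open>2 k0\<close> lies in the pair lattice. For \<open>l\<close> outside of it,
  \<open>cos (l \<cdot> x)\<close> is therefore orthogonal to the saturation space, and cannot be approximated even in
  \<open>L\<^sup>2\<close>.\<close>

lemma full_if_saturating:
  assumes K: "K \<noteq> {}" and sat: "cubically_saturating (forcing_profiles \<epsilon> K)"
  shows "pair_lattice \<epsilon> K = UNIV"
proof (rule ccontr)
  assume "pair_lattice \<epsilon> K \<noteq> UNIV"
  then obtain g0 where g0: "g0 \<notin> pair_lattice \<epsilon> K" by auto
  obtain k0 where k0: "k0 \<in> forcing_freqs \<epsilon> K" using K by (auto simp: forcing_freqs_def)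
  let ?B = "{k0 + g | g. g \<in> pair_lattice \<epsilon> K}"
  define l where "l = k0 + g0"
  have l1: "l \<notin> ?B" using g0 by (auto simp: l_def)
  have l2: "- l \<notin> ?B"
  proof
    assume "- l \<in> ?B"
    then obtain g where g: "g \<in> pair_lattice \<epsilon> K" "- l = k0 + g" by blast
    have "g0 = - ((k0 + k0) + g)" using g(2) by (simp add: l_def algebra_simps eq_neg_iff_add_eq_0 neg_eq_iff_add_eq_0)
    also have "\<dots> \<in> pair_lattice \<epsilon> K"
      by (intro int_vec.subspace_neg[OF pair_lattice_subspace] int_vec.subspace_add[OF pair_lattice_subspace]
          pair_latticeI k0 g(1))
    finally show False using g0 by simp
  qed
  let ?u = "\<lambda>x. cos (freq_dot l x)"
  have u: "?u \<in> fun_module.span (harmonics UNIV)"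
    by (intro fun_module.span_base in_harmonics UNIV_I)
  have us: "?u \<in> square_integrable" using harmonic_span_square_integrable[OF u] .
  have pos: "sqrt (L2_inner ?u ?u) > 0" using L2_inner_cos_pos by simp
  have "\<forall>u\<in>torus_H1. \<forall>e>0. \<exists>f\<in>sat_space (forcing_profiles \<epsilon> K). H1_norm (\<lambda>x. u x - f x) < e"
    using sat unfolding cubically_saturating_def dense_in_H1_def by (rule conjunct2)
  from this[rule_format, OF harmonic_span_H1[OF u] pos] obtain f where f: "f \<in> sat_space (forcing_profiles \<epsilon> K)"
    "H1_norm (\<lambda>x. ?u x - f x) < sqrt (L2_inner ?u ?u)"
    by (elim bexE)
  have fB: "f \<in> fun_module.span (harmonics ?B)"
    using f(1) sat_space_subset_harmonic_span[OF k0] by blast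
  have fs: "f \<in> square_integrable" using harmonic_span_square_integrable[OF fB] .
  have "L2_inner ?u f = 0"
    by (rule L2_orthogonal_span[OF us harmonics_square_integrable cos_orthogonal_harmonics[OF l1 l2] fB])
  then have "L2_inner (?u - f) (?u - f) = L2_inner ?u ?u + L2_inner f f"
    using us fs by (simp only: L2_inner_diff_left L2_inner_diff_right square_integrable_diff L2_inner_commute[of f ?u])
  then have "L2_inner ?u ?u \<le> L2_inner (?u - f) (?u - f)" using L2_inner_nonneg[of f] by linarith
  also have "\<dots> \<le> L2_inner (?u - f) (?u - f) + (\<Sum>j\<in>UNIV. L2_inner (weak_partial j (?u - f)) (weak_partial j (?u - f)))"
    using sum_nonneg[of UNIV "\<lambda>j::3. L2_inner (weak_partial j (?u - f)) (weak_partial j (?u - f))"] L2_inner_nonneg by simp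
  finally have "sqrt (L2_inner ?u ?u) \<le> H1_norm (?u - f)"
    unfolding H1_norm_def set_integral_torus L2_inner_self[symmetric] by (simp only: real_sqrt_le_iff)
  then show False using f(2) by (simp add: fun_diff_def)
qed

theorem theorem4p19:
  fixes K :: "(int^3) set" and \<epsilon> :: nat
  assumes "finite K" and "K \<noteq> {}" and "0 \<notin> K" and "K \<inter> uminus ` K = {}"
    and "\<epsilon> \<in> {0, 1}"
  shows "(\<forall>k0 \<in> forcing_freqs \<epsilon> K.
            sat_space_complex (forcing_profiles \<epsilon> K) =
              fun_module.span (fourier_mode ` {k0 + g | g. g \<in> pair_lattice \<epsilon> K})) \<and>
         (cubically_saturating (forcing_profiles \<epsilon> K) \<longleftrightarrow> pair_lattice \<epsilon> K = UNIV) \<and>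
         (pair_lattice \<epsilon> K = UNIV \<longleftrightarrow>
            \<not> (\<exists>\<theta>::real^3. \<exists>c\<in>{1, -1::complex}. \<theta> \<notin> period_lattice \<and>
                 (\<forall>k\<in>K. exp (\<i> * complex_of_real (freq_dot k \<theta>)) = c) \<and>
                 (\<epsilon> = 1 \<longrightarrow> c = 1)))"
  by (intro conjI ballI iffI[OF full_if_saturating saturating_if_full] pair_lattice_full_iff
      sat_space_complex_eq assms(2))

end
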